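(* Let $d\ge2$. Every extreme point of the set $(\Sigma^*_d)$ is a Suffridge polynomial in $(\Sigma_d)$, i.e. if $f$ is an extreme point of $(\Sigma^*_d)$ then the curve $f(\mathbb T)$ has exactly $d+1$ cusps and $d-2$ double points.
   Context: $(\Sigma_d)$ is the set of functions $f(z)=z+\frac{a_1}{z}+\dots+\frac{a_d}{z^d}$ univalent in $\Delta=\widehat{\mathbb C}\setminus\overline{\mathbb D}$, and $(\Sigma^*_d)=\{f\in(\Sigma_d): a_d=-1/d\}$, regarded as a subset of a finite-dimensional real vector space; an extreme point is one not expressible as $\frac12(f_1+f_2)$ with $f_1\ne f_2$ in $(\Sigma^*_d)$. $\mathbb T$ is the unit circle. A cusp of $f(\mathbb T)$ is a point $f(\zeta)$ with $|\zeta|=1$, $f'(\zeta)=0$; a double point is a point $f(\zeta_1)=f(\zeta_2)$ with $|\zeta_1|=|\zeta_2|=1$, $\zeta_1\ne\zeta_2$. A Suffridge polynomial in $(\Sigma_d)$ is an $f\in(\Sigma_d)$ for which $f(\mathbb T)$ has $d+1$ cusps and $d-2$ double points. *)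

theory Defs
  imports "HOL-Analysis.Analysis"
begin

definition fpoly :: "nat \<Rightarrow> (nat \<Rightarrow> complex) \<Rightarrow> complex \<Rightarrow> complex" where
  "fpoly d a z = z + (\<Sum>k=1..d. a k / z ^ k)"

definition coeffs_ok :: "nat \<Rightarrow> (nat \<Rightarrow> complex) \<Rightarrow> bool" where
  "coeffs_ok d a \<longleftrightarrow> (\<forall>k. (k = 0 \<or> k > d) \<longrightarrow> a k = 0)"

text \<open>(Sigma_d): univalent in Delta = complement of the closed unit disk (the point at
  infinity is mapped to infinity and no finite point maps there, so injectivity on the
  finite part is univalence on Delta).\<close>
definition Sigma_d :: "nat \<Rightarrow> (nat \<Rightarrow> complex) set" where
  "Sigma_d d = {a. coeffs_ok d a \<and> inj_on (fpoly d a) {z. norm z > 1}}"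

definition Sigma_star :: "nat \<Rightarrow> (nat \<Rightarrow> complex) set" where
  "Sigma_star d = {a \<in> Sigma_d d. a d = - 1 / of_nat d}"

definition extreme_point :: "(nat \<Rightarrow> complex) set \<Rightarrow> (nat \<Rightarrow> complex) \<Rightarrow> bool" where
  "extreme_point S a \<longleftrightarrow> a \<in> S \<and>
     \<not> (\<exists>a1\<in>S. \<exists>a2\<in>S. a1 \<noteq> a2 \<and> a = (\<lambda>k. (a1 k + a2 k) / 2))"

definition cusps :: "nat \<Rightarrow> (nat \<Rightarrow> complex) \<Rightarrow> complex set" where
  "cusps d a = {fpoly d a \<zeta> | \<zeta>. norm \<zeta> = 1 \<and> deriv (fpoly d a) \<zeta> = 0}"

definition double_points :: "nat \<Rightarrow> (nat \<Rightarrow> complex) \<Rightarrow> complex set" where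
  "double_points d a = {w. \<exists>\<zeta>1 \<zeta>2. norm \<zeta>1 = 1 \<and> norm \<zeta>2 = 1 \<and> \<zeta>1 \<noteq> \<zeta>2 \<and>
       fpoly d a \<zeta>1 = w \<and> fpoly d a \<zeta>2 = w}"

definition suffridge :: "nat \<Rightarrow> (nat \<Rightarrow> complex) \<Rightarrow> bool" where
  "suffridge d a \<longleftrightarrow> a \<in> Sigma_d d \<and>
     finite (cusps d a) \<and> card (cusps d a) = d + 1 \<and>
     finite (double_points d a) \<and> card (double_points d a) = d - 2"

end

theory Submission
  imports Defs "HOL-Complex_Analysis.Complex_Analysis"
    "HOL-Computational_Algebra.Fundamental_Theorem_Algebra"
begin

text \<open>
  The polynomial $z^{d+1} f'(z)$ is monic with constant term 1 and has no root outside the closed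
  disc, so its $d+1$ roots lie on the circle; univalence makes them simple with distinct images.
  Moreover it is self-inversive, so with $\omega = (d-1)/2$ one has
  $\frac{d}{dt} f(e^{it}) = i e^{-i \omega t} r(t)$ with $r$ real:
  the tangent direction is known explicitly and every arc between cusps is strictly concave.

  Upper bound: at a double point $f(e^{ix}) = f(e^{iy})$ the tangents are parallel, hence $y - x$ is
  an integer multiple of $2\pi/(d-1)$. The chords belonging to different double points do not cross,
  so they cut the circle into one face more than there are double points, and each face takes up at
  least one unit of length; hence there are at most $d-2$ double points.

  Lower bound: the Laurent polynomials $g$ for which $f + \epsilon g$ keeps $r$ real form a real space
  of dimension $d-2$. With fewer than $d-2$ double points some $g \neq 0$ displaces the two branches
  at each double point only tangentially. By concavity $f \pm \epsilon g$ then has no new boundary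
  self-intersection for small $\epsilon$, hence stays univalent, and $f$ is not extreme.
\<close>

section \<open>Derivatives and blow-up at the unit circle\<close>

text \<open>The boundary curve has cusps and touches itself, so neither the non-crossing of chords
  nor the univalence of f + eps g is a direct Jordan curve argument. Both come from the divided
  difference of f in the coordinates u = 1/z, v = 1/w, which has no zeros in the closed bidisc
  outside the torus. It has a continuous logarithm, and for interlaced chords the increments of that
  logarithm would be off by 2 pi i. For f + eps g its zeros are controlled by a homotopy on the
  discs u = t q, v = t, avoiding the finitely many q that come from double points or from the
  diagonal.

  Concavity is what makes a linear condition on g sufficient: since r is nonzero at a double point,
  the two branches stay strictly on opposite sides of their tangent lines, uniformly for small eps,
  and no second-order condition arises.

  The dimension d - 2 comes from pairing the coefficients k and d - 1 - k for k between 1 and d - 2: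
  a pair carries two real parameters, a middle index one. The coefficient a_d is normalised, and the
  index d - 1 would be paired with 0.\<close>

definition fprime :: "nat \<Rightarrow> (nat \<Rightarrow> complex) \<Rightarrow> complex \<Rightarrow> complex" where
  "fprime d a z = 1 - (\<Sum>k=1..d. of_nat k * a k / z ^ Suc k)"

lemma fpoly_has_field_derivative:
  assumes "z \<noteq> 0"
  shows "(fpoly d a has_field_derivative fprime d a z) (at z)"
proof -
  have tm: "((\<lambda>z. a k / z ^ k) has_field_derivative - (of_nat k * a k / z ^ Suc k)) (at z)"
    if "k \<in> {1..d}" for k
  proof -
    from that obtain m where k: "k = Suc m" by (cases k) auto
    have "((\<lambda>z. z ^ Suc m) has_field_derivative of_nat (Suc m) * z ^ m) (at z)"
      using DERIV_power_Suc[OF DERIV_ident, of m z] by simp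
    from DERIV_cmult[OF DERIV_inverse_fun[OF this], of "a k"] assms
    have "((\<lambda>z. a k * inverse (z ^ Suc m)) has_field_derivative
            a k * - (inverse (z ^ Suc m) * (of_nat (Suc m) * z ^ m) * inverse (z ^ Suc m))) (at z)"
      by (simp add: mult_ac)
    moreover have "a k * - (inverse (z ^ Suc m) * (of_nat (Suc m) * z ^ m) * inverse (z ^ Suc m))
        = - (of_nat k * a k / z ^ Suc k)"
      using assms by (simp add: k divide_simps del: of_nat_Suc)
    ultimately show ?thesis by (simp only: k divide_inverse)
  qed
  have "((\<lambda>z. z + (\<Sum>k=1..d. a k / z ^ k)) has_field_derivative
          1 + (\<Sum>k=1..d. - (of_nat k * a k / z ^ Suc k))) (at z)"
    by (intro DERIV_add DERIV_ident DERIV_sum tm)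
  moreover have "(\<lambda>z. z + (\<Sum>k=1..d. a k / z ^ k)) = fpoly d a"
    by (simp add: fpoly_def fun_eq_iff)
  ultimately show ?thesis
    by (simp add: fprime_def sum_negf)
qed

lemma deriv_fpoly: "z \<noteq> 0 \<Longrightarrow> deriv (fpoly d a) z = fprime d a z"
  by (rule DERIV_imp_deriv) (rule fpoly_has_field_derivative)

lemma fpoly_holomorphic [holomorphic_intros]:
  assumes "0 \<notin> S"
  shows "fpoly d a holomorphic_on S"
proof -
  have "fpoly d a field_differentiable (at z within S)" if "z \<in> S" for z
    using fpoly_has_field_derivative[of z d a] that assms
    by (metis field_differentiable_def has_field_derivative_at_within)
  thus ?thesis unfolding holomorphic_on_def by blast
qed

lemma open_exterior: "open {z::complex. 1 < norm z}"
  by (intro open_Collect_less continuous_intros)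

lemma fprime_nonzero:
  assumes "a \<in> Sigma_d d" "norm z > 1"
  shows "fprime d a z \<noteq> 0"
proof -
  have "deriv (fpoly d a) z \<noteq> 0"
  proof (rule holomorphic_injective_imp_regular[OF _ open_exterior])
    show "fpoly d a holomorphic_on {z. 1 < norm z}" by (intro holomorphic_intros) auto
    show "inj_on (fpoly d a) {z. 1 < norm z}" using assms by (simp add: Sigma_d_def)
    show "z \<in> {z. 1 < norm z}" using assms by simp
  qed
  moreover have "z \<noteq> 0" using assms by auto
  ultimately show ?thesis by (simp add: deriv_fpoly)
qed

text \<open>Since the whole right half-plane is mapped into the exterior at every scale $s$, rescaling limits of $f$ at a
  boundary point inherit univalence there by Hurwitz's theorem.\<close>

lemma norm_one_plus_gt_one:
  assumes "norm \<zeta> = 1" "s > 0" "Re x > 0"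
  shows "norm (\<zeta> * (1 + of_real s * x)) > 1"
proof -
  have "1 < Re (1 + of_real s * x)" using assms by simp
  also have "\<dots> \<le> norm (1 + of_real s * x)" by (rule complex_Re_le_cmod)
  finally show ?thesis using assms by (simp add: norm_mult)
qed

text \<open>In the coordinate x one has z - \<zeta> = \<zeta> s x, so division by s^n removes the
  scale, and only the value of the cofactor g at \<zeta> survives as s tends to 0.\<close>

lemma blowup_uniform_limit:
  fixes f g :: "complex \<Rightarrow> complex" and s :: "nat \<Rightarrow> real"
  assumes r: "r > 0" and fac: "\<And>z. z \<in> ball \<zeta> r \<Longrightarrow> f z - f \<zeta> = (z - \<zeta>) ^ n * g z"
    and g: "isCont g \<zeta>" and s: "\<And>j. s j > 0" "s \<longlonglongrightarrow> 0" and K: "bounded K"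
  shows "uniform_limit K (\<lambda>j x. (f (\<zeta> * (1 + of_real (s j) * x)) - f \<zeta>) / of_real (s j) ^ n)
           (\<lambda>x. \<zeta> ^ n * g \<zeta> * x ^ n) sequentially"
proof (rule uniform_limitI)
  fix e :: real assume e: "e > 0"
  obtain M where M: "M > 0" "\<And>x. x \<in> K \<Longrightarrow> norm x \<le> M"
    using K unfolding bounded_pos by blast
  \<comment> \<open>The summand 1 keeps C positive even when \<zeta> = 0.\<close>
  define C where "C = (norm \<zeta> * M) ^ n + 1"
  have C: "C > 0" using M by (auto simp: C_def intro!: add_nonneg_pos)
  obtain \<delta> where \<delta>: "\<delta> > 0" "\<And>z. dist z \<zeta> < \<delta> \<Longrightarrow> dist (g z) (g \<zeta>) < e / C"
    using g e C unfolding continuous_at_eps_delta by (metis divide_pos_pos)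
  define \<eta> where "\<eta> = min \<delta> r"
  have \<eta>: "\<eta> > 0" using \<delta> r by (simp add: \<eta>_def)
  have "(\<lambda>j. norm \<zeta> * s j * M) \<longlonglongrightarrow> norm \<zeta> * 0 * M"
    by (intro tendsto_intros s)
  hence "\<forall>\<^sub>F j in sequentially. norm \<zeta> * s j * M < \<eta>"
    using \<eta> by (auto dest: order_tendstoD)
  thus "\<forall>\<^sub>F j in sequentially. \<forall>x\<in>K. dist ((f (\<zeta> * (1 + of_real (s j) * x)) - f \<zeta>) / of_real (s j) ^ n)
           (\<zeta> ^ n * g \<zeta> * x ^ n) < e"
  proof eventually_elim
    case (elim j)
    show ?case
    proof
      fix x assume x: "x \<in> K"
      define z where "z = \<zeta> * (1 + of_real (s j) * x)"
      have zz: "z - \<zeta> = \<zeta> * of_real (s j) * x" by (simp add: z_def algebra_simps)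
      have "norm (z - \<zeta>) = norm \<zeta> * s j * norm x"
        unfolding zz using s(1)[of j] by (simp add: norm_mult)
      also have "\<dots> \<le> norm \<zeta> * s j * M"
        using M(2)[OF x] s(1)[of j] by (intro mult_left_mono) auto
      finally have d: "dist z \<zeta> < \<eta>" using elim by (simp add: dist_norm)
      have "f z - f \<zeta> = (z - \<zeta>) ^ n * g z"
        using d by (intro fac) (auto simp: \<eta>_def dist_commute)
      hence eq: "(f z - f \<zeta>) / of_real (s j) ^ n = \<zeta> ^ n * x ^ n * g z"
        unfolding zz using s(1)[of j] by (simp add: power_mult_distrib)
      have "dist ((f z - f \<zeta>) / of_real (s j) ^ n) (\<zeta> ^ n * g \<zeta> * x ^ n)
              = norm (\<zeta> ^ n * x ^ n * (g z - g \<zeta>))"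
        unfolding eq dist_norm by (simp add: algebra_simps)
      also have "\<dots> = (norm \<zeta> * norm x) ^ n * dist (g z) (g \<zeta>)"
        by (simp add: norm_mult norm_power power_mult_distrib dist_norm)
      also have "\<dots> \<le> (norm \<zeta> * M) ^ n * dist (g z) (g \<zeta>)"
        using M(2)[OF x] by (intro mult_right_mono power_mono mult_left_mono) auto
      also have "\<dots> \<le> C * dist (g z) (g \<zeta>)"
        by (intro mult_right_mono) (auto simp: C_def)
      also have "\<dots> < C * (e / C)"
        using d \<delta>(2)[of z] C by (intro mult_strict_left_mono) (auto simp: \<eta>_def)
      also have "\<dots> = e" using C by simp
      finally show "dist ((f (\<zeta> * (1 + of_real (s j) * x)) - f \<zeta>) / of_real (s j) ^ n)
           (\<zeta> ^ n * g \<zeta> * x ^ n) < e" unfolding z_def .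
    qed
  qed
qed

section \<open>Local factorization at boundary points and its limits under univalence\<close>

lemma fpoly_not_constant:
  "\<not> (\<lambda>z. fpoly d a z - w) constant_on (- {0})"
proof
  assume "(\<lambda>z. fpoly d a z - w) constant_on (- {0})"
  then obtain c where c: "\<And>z. z \<noteq> 0 \<Longrightarrow> fpoly d a z - w = c"
    unfolding constant_on_def by auto
  \<comment> \<open>f(z) - z tends to 0 at infinity, so a constant f would make the identity map
    converge there.\<close>
  have "((\<lambda>z. z + (\<Sum>k=1..d. a k / z ^ k) - z) \<longlongrightarrow> 0) at_infinity"
    by (simp, intro tendsto_null_sum tendsto_divide_0[OF tendsto_const] filterlim_power_at_infinity filterlim_ident) auto
  hence "((\<lambda>z. c + w - z) \<longlongrightarrow> 0) at_infinity"
  proof (rule Lim_transform_eventually)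
    have "\<forall>\<^sub>F z::complex in at_infinity. z \<noteq> 0"
      unfolding eventually_at_infinity by (rule exI[of _ 1]) auto
    thus "\<forall>\<^sub>F z in at_infinity. z + (\<Sum>k=1..d. a k / z ^ k) - z = c + w - z"
      by eventually_elim (use c in \<open>auto simp: fpoly_def algebra_simps\<close>)
  qed
  hence "((\<lambda>z::complex. (c + w) - (c + w - z)) \<longlongrightarrow> (c + w) - 0) at_infinity"
    by (intro tendsto_intros)
  hence "((\<lambda>z::complex. z) \<longlongrightarrow> c + w) at_infinity" by simp
  thus False
    using not_tendsto_and_filterlim_at_infinity[OF _ _ filterlim_ident] trivial_limit_at_infinity
    by blast
qed

lemma fpoly_factor:
  assumes "\<zeta> \<noteq> 0"
  obtains g r n where "0 < n" "0 < r" "g holomorphic_on ball \<zeta> r"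
    "\<And>z. z \<in> ball \<zeta> r \<Longrightarrow> fpoly d a z - fpoly d a \<zeta> = (z - \<zeta>) ^ n * g z" "g \<zeta> \<noteq> 0"
proof -
  have "(\<lambda>z. fpoly d a z - fpoly d a \<zeta>) holomorphic_on (- {0})"
    by (intro holomorphic_intros) auto
  moreover have "connected (- {0::complex})" by (simp add: connected_punctured_universe)
  ultimately obtain g r n
    where "0 < n" "0 < r" "g holomorphic_on ball \<zeta> r"
          "\<And>w. w \<in> ball \<zeta> r \<Longrightarrow> fpoly d a w - fpoly d a \<zeta> = (w - \<zeta>)^n * g w"
          "\<And>w. w \<in> ball \<zeta> r \<Longrightarrow> g w \<noteq> 0"
    using holomorphic_factor_zero_nonconstant[of "\<lambda>z. fpoly d a z - fpoly d a \<zeta>" "- {0}" \<zeta>]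
      fpoly_not_constant[of d a "fpoly d a \<zeta>"] assms
    by (metis (no_types, lifting) Compl_iff cancel_comm_monoid_add_class.diff_cancel empty_iff insert_iff open_Compl closed_singleton)
  thus ?thesis using that[of n r g] by auto
qed

lemma right_half_plane: "open {x. 0 < Re x}" "connected {x. 0 < Re x}" "convex {x. 0 < Re x}"
proof -
  show "convex {x. 0 < Re x}" by (rule convex_halfspace_Re_gt)
  thus "connected {x. 0 < Re x}" by (rule convex_connected)
qed (simp add: open_halfspace_Re_gt)

lemma power_not_constant:
  fixes c :: complex
  assumes "c \<noteq> 0" "n > 0" "open S" "x \<in> S"
  shows "\<not> (\<lambda>x. c * x ^ n - w) constant_on S"
proof
  assume "(\<lambda>x. c * x ^ n - w) constant_on S"
  then obtain C where C: "\<And>x. x \<in> S \<Longrightarrow> c * x ^ n - w = C"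
    unfolding constant_on_def by auto
  have "S \<subseteq> {x. poly (monom c n - [:w + C:]) x = 0}"
    using C by (auto simp: poly_monom algebra_simps)
  moreover have "monom c n - [:w + C:] \<noteq> 0"
  proof
    assume "monom c n - [:w + C:] = 0"
    hence "coeff (monom c n - [:w + C:]) n = 0" by simp
    thus False using assms by (simp add: coeff_pCons split: nat.splits)
  qed
  ultimately have "finite S" using poly_roots_finite finite_subset by blast
  thus False using assms finite_imp_not_open by auto
qed

text \<open>The blow-up limit is a monomial of degree n, injective on the right half-plane by
  Hurwitz's theorem. The half-plane has opening pi and x^n multiplies angles by n, so for n >= 3 the
  image overlaps itself; n = 2 is the cusp.\<close>

lemma univalent_boundary_order_le_2:
  assumes a: "a \<in> Sigma_d d" and \<zeta>: "norm \<zeta> = 1"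
    and fac: "0 < n" "0 < r" "g holomorphic_on ball \<zeta> r"
    "\<And>z. z \<in> ball \<zeta> r \<Longrightarrow> fpoly d a z - fpoly d a \<zeta> = (z - \<zeta>) ^ n * g z" "g \<zeta> \<noteq> 0"
  shows "n \<le> 2"
proof (rule ccontr)
  assume "\<not> n \<le> 2"
  hence n: "n \<ge> 3" by simp
  have \<zeta>0: "\<zeta> \<noteq> 0" using \<zeta> by auto
  define S where "S = {x. 0 < Re x}"
  define s where "s = (\<lambda>j. 1 / real (Suc j))"
  have s: "s j > 0" for j by (simp add: s_def)
  have s0: "s \<longlonglongrightarrow> 0" unfolding s_def using LIMSEQ_Suc[OF lim_1_over_n] by simp
  have cont: "isCont g \<zeta>"
    using fac by (metis centre_in_ball continuous_on_eq_continuous_at holomorphic_on_imp_continuous_on open_ball)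
  have ext: "\<zeta> * (1 + of_real (s j) * x) \<in> {z. 1 < norm z}" if "x \<in> S" for x j
    using norm_one_plus_gt_one[OF \<zeta> s] that by (simp add: S_def)
  have inj: "inj_on (\<lambda>x. \<zeta> ^ n * g \<zeta> * x ^ n) S"
  proof (rule Hurwitz_injective[where \<F> = "\<lambda>j x. (fpoly d a (\<zeta> * (1 + of_real (s j) * x)) - fpoly d a \<zeta>) / of_real (s j) ^ n"])
    show "open S" "connected S" using right_half_plane by (auto simp: S_def)
    show "(\<lambda>x. \<zeta> ^ n * g \<zeta> * x ^ n) holomorphic_on S" by (intro holomorphic_intros)
    show "(\<lambda>x. (fpoly d a (\<zeta> * (1 + of_real (s j) * x)) - fpoly d a \<zeta>) / of_real (s j) ^ n)
             holomorphic_on S" for j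
    proof -
      have "(fpoly d a \<circ> (\<lambda>x. \<zeta> * (1 + of_real (s j) * x))) holomorphic_on S"
      proof (rule holomorphic_on_compose_gen[where t = "{z. 1 < norm z}"])
        show "fpoly d a holomorphic_on {z. 1 < norm z}" by (intro holomorphic_intros) auto
      qed (use ext in \<open>auto intro!: holomorphic_intros\<close>)
      thus ?thesis using s[of j] by (intro holomorphic_intros) (auto simp: o_def)
    qed
    show "uniform_limit K (\<lambda>j x. (fpoly d a (\<zeta> * (1 + of_real (s j) * x)) - fpoly d a \<zeta>) / of_real (s j) ^ n)
           (\<lambda>x. \<zeta> ^ n * g \<zeta> * x ^ n) sequentially" if "compact K" for K
      by (rule blowup_uniform_limit[OF fac(2,4) cont s s0 compact_imp_bounded[OF that]])
    show "\<not> (\<lambda>x. \<zeta> ^ n * g \<zeta> * x ^ n) constant_on S"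
      using power_not_constant[of "\<zeta> ^ n * g \<zeta>" n S 1 0] \<zeta>0 fac right_half_plane
      by (auto simp: S_def)
    show "inj_on (\<lambda>x. (fpoly d a (\<zeta> * (1 + of_real (s j) * x)) - fpoly d a \<zeta>) / of_real (s j) ^ n) S" for j
    proof (rule inj_onI)
      fix x y assume xy: "x \<in> S" "y \<in> S"
        "(fpoly d a (\<zeta> * (1 + of_real (s j) * x)) - fpoly d a \<zeta>) / of_real (s j) ^ n =
         (fpoly d a (\<zeta> * (1 + of_real (s j) * y)) - fpoly d a \<zeta>) / of_real (s j) ^ n"
      hence "fpoly d a (\<zeta> * (1 + of_real (s j) * x)) = fpoly d a (\<zeta> * (1 + of_real (s j) * y))"
        using s[of j] by simp
      hence "\<zeta> * (1 + of_real (s j) * x) = \<zeta> * (1 + of_real (s j) * y)"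
        using a ext xy unfolding Sigma_d_def by (auto dest!: inj_onD)
      thus "x = y" using \<zeta> s[of j] by (auto simp: order_less_imp_not_eq2)
    qed
  qed
  \<comment> \<open>Two points with the same n-th power -1; they lie in the open right half-plane
    because n > 2.\<close>
  have pn: "0 < pi / n" "pi / n < pi / 2" using n by (auto simp: field_simps)
  have "cis (pi / n) \<in> S" "cis (- (pi / n)) \<in> S"
    using pn cos_gt_zero[of "pi / n"] by (auto simp: S_def)
  moreover have "cis (pi / n) ^ n = -1" "cis (- (pi / n)) ^ n = -1"
    unfolding Complex.DeMoivre using n by (simp_all add: complex_eq_iff)
  ultimately have "cis (pi / n) = cis (- (pi / n))"
    using inj_onD[OF inj, of "cis (pi / n)" "cis (- (pi / n))"] by simp
  hence "sin (pi / n) = - sin (pi / n)" by (simp add: complex_eq_iff)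
  moreover have "sin (pi / n) > 0" using pn pi_gt_zero by (intro sin_gt_zero) linarith+
  ultimately show False by simp
qed

text \<open>The scales are crossed, s^n2 at \<zeta>1 and s^n1 at \<zeta>2, so that both increments
  of f have order s^(n1 n2). Their difference has no zero by univalence, and Hurwitz's theorem, in x
  with y fixed, carries this over to the limit.\<close>

lemma univalent_boundary_sectors_disjoint:
  assumes a: "a \<in> Sigma_d d" and \<zeta>: "norm \<zeta>1 = 1" "norm \<zeta>2 = 1" "\<zeta>1 \<noteq> \<zeta>2"
    and eq: "fpoly d a \<zeta>1 = fpoly d a \<zeta>2"
    and fac1: "0 < n1" "0 < r1" "g1 holomorphic_on ball \<zeta>1 r1"
    "\<And>z. z \<in> ball \<zeta>1 r1 \<Longrightarrow> fpoly d a z - fpoly d a \<zeta>1 = (z - \<zeta>1) ^ n1 * g1 z" "g1 \<zeta>1 \<noteq> 0"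
    and fac2: "0 < n2" "0 < r2" "g2 holomorphic_on ball \<zeta>2 r2"
    "\<And>z. z \<in> ball \<zeta>2 r2 \<Longrightarrow> fpoly d a z - fpoly d a \<zeta>2 = (z - \<zeta>2) ^ n2 * g2 z" "g2 \<zeta>2 \<noteq> 0"
    and xy: "Re x > 0" "Re y > 0"
  shows "\<zeta>1 ^ n1 * g1 \<zeta>1 * x ^ n1 \<noteq> \<zeta>2 ^ n2 * g2 \<zeta>2 * y ^ n2"
proof -
  have \<zeta>10: "\<zeta>1 \<noteq> 0" using \<zeta> by auto
  define M where "M = norm x + norm y + 1"
  have M: "M > 0" "norm x < M" "norm y < M" by (auto simp: M_def intro: add_nonneg_pos add_pos_nonneg)
  define S where "S = {x. 0 < Re x} \<inter> ball 0 M"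
  have S: "open S" "connected S" "x \<in> S" "convex S"
    using right_half_plane M xy unfolding S_def
    by (auto intro!: open_Int convex_connected convex_Int)
  \<comment> \<open>Scales up to c keep each moving point closer to its base point than half the
    distance of \<zeta>1 and \<zeta>2; the two points then differ and univalence applies.\<close>
  define c where "c = min 1 (norm (\<zeta>1 - \<zeta>2) / (2 * M))"
  have c: "c > 0" "c \<le> 1" "c * M \<le> norm (\<zeta>1 - \<zeta>2) / 2"
  proof -
    have "c * M \<le> norm (\<zeta>1 - \<zeta>2) / (2 * M) * M" using M by (intro mult_right_mono) (auto simp: c_def)
    thus "c * M \<le> norm (\<zeta>1 - \<zeta>2) / 2" using M by simp
  qed (use M \<zeta> in \<open>auto simp: c_def\<close>)
  define s where "s = (\<lambda>j. c / real (Suc j))"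
  have s: "s j > 0" "s j \<le> c" for j using c by (auto simp: s_def divide_le_eq)
  have s0: "s \<longlonglongrightarrow> 0" unfolding s_def
    using tendsto_mult[OF tendsto_const[of c] LIMSEQ_Suc[OF lim_1_over_n]] by simp
  have sp: "s j ^ n > 0" "s j ^ n \<le> c" if "n > 0" for j n
  proof -
    have "s j ^ n \<le> s j ^ 1" using s[of j] c that by (intro power_decreasing) auto
    thus "s j ^ n \<le> c" using s[of j] by simp
  qed (use s in simp)
  have sp0: "(\<lambda>j. s j ^ n) \<longlonglongrightarrow> 0" if "n > 0" for n
    using tendsto_power[OF s0, of n] that by (simp add: zero_power)
  define z1 where "z1 = (\<lambda>j x. \<zeta>1 * (1 + of_real (s j ^ n2) * x))"
  define z2 where "z2 = (\<lambda>j. \<zeta>2 * (1 + of_real (s j ^ n1) * y))"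
  have ext1: "z1 j x \<in> {z. 1 < norm z}" if "x \<in> S" for x j
    using norm_one_plus_gt_one[OF \<zeta>(1) sp(1)[OF fac2(1)]] that by (simp add: S_def z1_def)
  have ext2: "z2 j \<in> {z. 1 < norm z}" for j
    using norm_one_plus_gt_one[OF \<zeta>(2) sp(1)[OF fac1(1)] xy(2)] by (simp add: z2_def)
  have ne: "z1 j x \<noteq> z2 j" if "x \<in> S" for x j
  proof
    assume e: "z1 j x = z2 j"
    have "norm (z1 j x - \<zeta>1) = s j ^ n2 * norm x"
      using \<zeta> sp(1)[OF fac2(1), of j] by (simp add: z1_def ring_distribs norm_mult norm_power s abs_of_pos)
    also have "\<dots> \<le> c * norm x" using sp[OF fac2(1), of j] by (intro mult_right_mono) auto
    also have "\<dots> < c * M" using that c by (intro mult_strict_left_mono) (auto simp: S_def)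
    finally have 1: "norm (z1 j x - \<zeta>1) < norm (\<zeta>1 - \<zeta>2) / 2" using c by simp
    have "norm (z2 j - \<zeta>2) = s j ^ n1 * norm y"
      using \<zeta> sp(1)[OF fac1(1), of j] by (simp add: z2_def ring_distribs norm_mult norm_power s abs_of_pos)
    also have "\<dots> \<le> c * norm y" using sp[OF fac1(1), of j] by (intro mult_right_mono) auto
    also have "\<dots> < c * M" using M c by (intro mult_strict_left_mono) auto
    finally have 2: "norm (z2 j - \<zeta>2) < norm (\<zeta>1 - \<zeta>2) / 2" using c by simp
    have "norm (\<zeta>1 - \<zeta>2) \<le> norm (z2 j - \<zeta>2) + norm (z1 j x - \<zeta>1)"
      unfolding e using norm_triangle_ineq4[of "z2 j - \<zeta>2" "z2 j - \<zeta>1"] by simp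
    thus False using 1 2 by simp
  qed
  have c1: "isCont g1 \<zeta>1" and c2: "isCont g2 \<zeta>2"
    using fac1 fac2
    by (metis centre_in_ball continuous_on_eq_continuous_at holomorphic_on_imp_continuous_on open_ball)+
  define F where "F = (\<lambda>j x. (fpoly d a (z1 j x) - fpoly d a \<zeta>1) / of_real (s j ^ n2) ^ n1
                        - (fpoly d a (z2 j) - fpoly d a \<zeta>2) / of_real (s j ^ n1) ^ n2)"
  define w where "w = \<zeta>2 ^ n2 * g2 \<zeta>2 * y ^ n2"
  have nz: "F j x \<noteq> 0" if "x \<in> S" for j x
  proof -
    have "F j x = (fpoly d a (z1 j x) - fpoly d a (z2 j)) / of_real (s j) ^ (n1 * n2)"
      by (simp add: F_def eq diff_divide_distrib mult.commute flip: power_mult)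
    moreover have "fpoly d a (z1 j x) \<noteq> fpoly d a (z2 j)"
      using a ext1[OF that] ext2 ne[OF that, of j] unfolding Sigma_d_def by (auto dest: inj_onD)
    ultimately show ?thesis using s(1)[of j] by simp
  qed
  have "\<zeta>1 ^ n1 * g1 \<zeta>1 * x ^ n1 - w \<noteq> 0"
  proof (rule Hurwitz_no_zeros[where S = S and \<F> = F and g = "\<lambda>x. \<zeta>1 ^ n1 * g1 \<zeta>1 * x ^ n1 - w"])
    show "(\<lambda>x. \<zeta>1 ^ n1 * g1 \<zeta>1 * x ^ n1 - w) holomorphic_on S" by (intro holomorphic_intros)
    show "F j holomorphic_on S" for j
    proof -
      have "(fpoly d a \<circ> z1 j) holomorphic_on S"
      proof (rule holomorphic_on_compose_gen[where t = "{z. 1 < norm z}"])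
        show "fpoly d a holomorphic_on {z. 1 < norm z}" by (intro holomorphic_intros) auto
      qed (use ext1 in \<open>auto intro!: holomorphic_intros simp: z1_def\<close>)
      thus ?thesis using s(1)[of j] unfolding F_def by (intro holomorphic_intros) (auto simp: o_def)
    qed
    show "uniform_limit K F (\<lambda>x. \<zeta>1 ^ n1 * g1 \<zeta>1 * x ^ n1 - w) sequentially" if "compact K" for K
    proof -
      have 1: "uniform_limit K (\<lambda>j x. (fpoly d a (z1 j x) - fpoly d a \<zeta>1) / of_real (s j ^ n2) ^ n1)
             (\<lambda>x. \<zeta>1 ^ n1 * g1 \<zeta>1 * x ^ n1) sequentially"
        unfolding z1_def
        by (rule blowup_uniform_limit[OF fac1(2,4) c1 sp(1)[OF fac2(1)] sp0[OF fac2(1)] compact_imp_bounded[OF that]])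
      have 2: "uniform_limit {y} (\<lambda>j y. (fpoly d a (\<zeta>2 * (1 + of_real (s j ^ n1) * y)) - fpoly d a \<zeta>2) / of_real (s j ^ n1) ^ n2)
             (\<lambda>x. \<zeta>2 ^ n2 * g2 \<zeta>2 * x ^ n2) sequentially"
        by (rule blowup_uniform_limit[OF fac2(2,4) c2 sp(1)[OF fac1(1)] sp0[OF fac1(1)]]) auto
      have "(\<lambda>j. (fpoly d a (z2 j) - fpoly d a \<zeta>2) / of_real (s j ^ n1) ^ n2) \<longlonglongrightarrow> w"
        using tendsto_uniform_limitI[OF 2] by (simp add: w_def z2_def)
      hence "uniform_limit K (\<lambda>j _. (fpoly d a (z2 j) - fpoly d a \<zeta>2) / of_real (s j ^ n1) ^ n2) (\<lambda>_. w) sequentially"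
        by (auto simp: uniform_limit_iff tendsto_iff elim: eventually_mono)
      from uniform_limit_minus[OF 1 this] show ?thesis by (simp add: F_def)
    qed
    show "\<not> (\<lambda>x. \<zeta>1 ^ n1 * g1 \<zeta>1 * x ^ n1 - w) constant_on S"
      using power_not_constant[of "\<zeta>1 ^ n1 * g1 \<zeta>1" n1 S x w] \<zeta>10 fac1 S by auto
  qed (use S nz in auto)
  thus ?thesis by (simp add: w_def)
qed

lemma factor_derivatives:
  assumes \<zeta>: "\<zeta> \<noteq> 0" and fac: "0 < n" "0 < r" "g holomorphic_on ball \<zeta> r"
    "\<And>z. z \<in> ball \<zeta> r \<Longrightarrow> fpoly d a z - fpoly d a \<zeta> = (z - \<zeta>) ^ n * g z"
  shows "n = 1 \<Longrightarrow> fprime d a \<zeta> = g \<zeta>"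
    and "n \<noteq> 1 \<Longrightarrow> fprime d a \<zeta> = 0"
    and "n = 2 \<Longrightarrow> (fprime d a has_field_derivative 2 * g \<zeta>) (at \<zeta>)"
proof -
  have gd: "(g has_field_derivative deriv g z) (at z)" if "z \<in> ball \<zeta> r" for z
    using fac(3) that by (intro holomorphic_derivI) auto
  have fp: "fprime d a z = of_nat n * (z - \<zeta>) ^ (n - 1) * g z + (z - \<zeta>) ^ n * deriv g z"
    if z: "z \<in> ball \<zeta> r" "z \<noteq> 0" for z
  proof (rule DERIV_unique)
    show "(fpoly d a has_field_derivative fprime d a z) (at z)"
      by (rule fpoly_has_field_derivative) fact
    have "((\<lambda>z. fpoly d a \<zeta> + (z - \<zeta>) ^ n * g z) has_field_derivative
        of_nat n * (z - \<zeta>) ^ (n - 1) * g z + (z - \<zeta>) ^ n * deriv g z) (at z)"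
      by (auto intro!: derivative_eq_intros gd z)
    thus "(fpoly d a has_field_derivative
        of_nat n * (z - \<zeta>) ^ (n - 1) * g z + (z - \<zeta>) ^ n * deriv g z) (at z)"
      by (rule has_field_derivative_transform_within_open[OF _ open_ball z(1)])
         (use fac(4) in \<open>auto simp: algebra_simps\<close>)
  qed
  show "n = 1 \<Longrightarrow> fprime d a \<zeta> = g \<zeta>" "n \<noteq> 1 \<Longrightarrow> fprime d a \<zeta> = 0"
    using fp[of \<zeta>] fac \<zeta> by (auto simp: zero_power)
  show "(fprime d a has_field_derivative 2 * g \<zeta>) (at \<zeta>)" if n: "n = 2"
  proof (rule has_field_derivative_transform_within_open)
    have g': "deriv g holomorphic_on ball \<zeta> r" using fac by (intro holomorphic_deriv) auto
    have "(deriv g has_field_derivative deriv (deriv g) \<zeta>) (at \<zeta>)"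
      using g' fac by (intro holomorphic_derivI) auto
    thus "((\<lambda>z. 2 * (z - \<zeta>) * g z + (z - \<zeta>) ^ 2 * deriv g z) has_field_derivative 2 * g \<zeta>) (at \<zeta>)"
      using gd[of \<zeta>] fac by (auto intro!: derivative_eq_intros)
    show "open (ball \<zeta> r - {0})" "\<zeta> \<in> ball \<zeta> r - {0}" using fac \<zeta> by auto
  qed (use fp n in auto)
qed

text \<open>The order of f - f(\<zeta>) is at least 2 because the derivative vanishes, and at most 2
  by the opening angle; at order 2 the second derivative is 2 g(\<zeta>), which is nonzero.\<close>

lemma simple_critical_point:
  assumes a: "a \<in> Sigma_d d" and \<zeta>: "norm \<zeta> = 1" and crit: "fprime d a \<zeta> = 0"
  shows "\<exists>c. c \<noteq> 0 \<and> (fprime d a has_field_derivative c) (at \<zeta>)"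
proof -
  have \<zeta>0: "\<zeta> \<noteq> 0" using \<zeta> by auto
  from fpoly_factor[OF this, of d a] obtain g r n where
    fac: "0 < n" "0 < r" "g holomorphic_on ball \<zeta> r"
    "\<And>z. z \<in> ball \<zeta> r \<Longrightarrow> fpoly d a z - fpoly d a \<zeta> = (z - \<zeta>) ^ n * g z" "g \<zeta> \<noteq> 0" by metis
  have "n \<le> 2" by (rule univalent_boundary_order_le_2[OF a \<zeta> fac])
  moreover have "n \<noteq> 1" using factor_derivatives(1)[OF \<zeta>0 fac(1-4)] fac(5) crit by auto
  ultimately have "n = 2" using fac(1) by simp
  thus ?thesis using factor_derivatives(3)[OF \<zeta>0 fac(1-4)] fac(5) by (intro exI[of _ "2 * g \<zeta>"]) auto
qed

text \<open>Squaring the half-plane gives the plane slit along a ray, and the other image, being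
  open, does not fit into a ray. Consequently a cusp cannot be a double point.\<close>

lemma sector_2_meets:
  assumes "A \<noteq> 0" "B \<noteq> 0" "0 < n" "n \<le> 2"
  shows "\<exists>x y. Re x > 0 \<and> Re y > 0 \<and> A * x ^ 2 = B * y ^ n"
proof -
  define q where "q = B / A"
  have q: "q \<noteq> 0" using assms by (simp add: q_def)
  have "\<exists>y. Re y > 0 \<and> q * y ^ n \<notin> \<real>\<^sub>\<le>\<^sub>0"
  proof (cases "q \<in> \<real>\<^sub>\<le>\<^sub>0")
    case False thus ?thesis by (intro exI[of _ 1]) auto
  next
    case True
    then obtain t where t: "q = of_real t" "t \<le> 0" by (elim nonpos_Reals_cases)
    have "n = 1 \<or> n = 2" using assms by auto
    \<comment> \<open>Neither 1 + i nor (1 + i)^2 = 2 i is real, so a negative factor cannot put it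
      on the slit.\<close>
    thus ?thesis
      using t q by (intro exI[of _ "1 + \<i>"]) (auto simp: complex_nonpos_Reals_iff power2_eq_square)
  qed
  then obtain y where y: "Re y > 0" "q * y ^ n \<notin> \<real>\<^sub>\<le>\<^sub>0" by auto
  have "Re (csqrt (q * y ^ n)) > 0"
  proof (rule ccontr)
    assume "\<not> ?thesis"
    hence "Re (csqrt (q * y ^ n)) = 0" using Re_csqrt[of "q * y ^ n"] by linarith
    hence "csqrt (q * y ^ n) ^ 2 \<in> \<real>\<^sub>\<le>\<^sub>0"
      by (simp add: complex_nonpos_Reals_iff power2_eq_square)
    thus False using y(2) by simp
  qed
  moreover have "A * csqrt (q * y ^ n) ^ 2 = B * y ^ n"
    using assms by (simp add: q_def)
  ultimately show ?thesis using y by blast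
qed

text \<open>With cusps excluded both orders are 1, and the blow-up images are open half-planes
  through 0 with inner normals \<zeta> f'(\<zeta>). Such half-planes are disjoint only if the
  normals are opposite.\<close>

lemma double_point_tangency:
  assumes a: "a \<in> Sigma_d d" and \<zeta>: "norm \<zeta>1 = 1" "norm \<zeta>2 = 1" "\<zeta>1 \<noteq> \<zeta>2"
    and eq: "fpoly d a \<zeta>1 = fpoly d a \<zeta>2"
  shows "fprime d a \<zeta>1 \<noteq> 0" "fprime d a \<zeta>2 \<noteq> 0"
    "\<exists>t<0. \<zeta>1 * fprime d a \<zeta>1 = of_real t * (\<zeta>2 * fprime d a \<zeta>2)"
proof -
  have \<zeta>0: "\<zeta>1 \<noteq> 0" "\<zeta>2 \<noteq> 0" using \<zeta> by auto
  from fpoly_factor[OF \<zeta>0(1), of d a] obtain g1 r1 n1 where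
    fac1: "0 < n1" "0 < r1" "g1 holomorphic_on ball \<zeta>1 r1"
    "\<And>z. z \<in> ball \<zeta>1 r1 \<Longrightarrow> fpoly d a z - fpoly d a \<zeta>1 = (z - \<zeta>1) ^ n1 * g1 z" "g1 \<zeta>1 \<noteq> 0" by metis
  from fpoly_factor[OF \<zeta>0(2), of d a] obtain g2 r2 n2 where
    fac2: "0 < n2" "0 < r2" "g2 holomorphic_on ball \<zeta>2 r2"
    "\<And>z. z \<in> ball \<zeta>2 r2 \<Longrightarrow> fpoly d a z - fpoly d a \<zeta>2 = (z - \<zeta>2) ^ n2 * g2 z" "g2 \<zeta>2 \<noteq> 0" by metis
  note ne = univalent_boundary_sectors_disjoint[OF a \<zeta> eq fac1 fac2]
  define A where "A = \<zeta>1 ^ n1 * g1 \<zeta>1"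
  define B where "B = \<zeta>2 ^ n2 * g2 \<zeta>2"
  have AB: "A \<noteq> 0" "B \<noteq> 0" using fac1 fac2 \<zeta>0 by (auto simp: A_def B_def)
  have le: "n1 \<le> 2" "n2 \<le> 2"
    using univalent_boundary_order_le_2[OF a \<zeta>(1) fac1] univalent_boundary_order_le_2[OF a \<zeta>(2) fac2] by auto
  have "n1 \<noteq> 2"
    using sector_2_meets[OF AB fac2(1) le(2)] ne unfolding A_def B_def by auto
  moreover have "n2 \<noteq> 2"
    using sector_2_meets[OF AB(2,1) fac1(1) le(1)] ne unfolding A_def B_def by force
  ultimately have n: "n1 = 1" "n2 = 1" using le fac1(1) fac2(1) by auto
  have fp: "fprime d a \<zeta>1 = g1 \<zeta>1" "fprime d a \<zeta>2 = g2 \<zeta>2"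
    using factor_derivatives(1)[OF \<zeta>0(1) fac1(1-4) n(1)] factor_derivatives(1)[OF \<zeta>0(2) fac2(1-4) n(2)] by auto
  show "fprime d a \<zeta>1 \<noteq> 0" "fprime d a \<zeta>2 \<noteq> 0" using fp fac1 fac2 by auto
  define q where "q = A / B"
  have q0: "q \<noteq> 0" using AB by (simp add: q_def)
  \<comment> \<open>Re x = Re q + |q|, and q x = |q| (|q| + q) has |q| times this real part; hence x
    and q x both lie in the right half-plane unless q is real and negative.\<close>
  define x where "x = cnj q + of_real (norm q)"
  have "Re q \<le> - norm q"
  proof (rule ccontr)
    assume "\<not> Re q \<le> - norm q"
    hence h: "Re q + norm q > 0" by simp
    have "q * x = of_real (norm q) * (of_real (norm q) + q)"
      by (simp add: x_def ring_distribs power2_eq_square flip: complex_norm_square) 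
    hence "Re (q * x) = norm q * (norm q + Re q)" by simp
    hence "Re (q * x) > 0" using h q0 by simp
    moreover have "Re x > 0" using h by (simp add: x_def)
    moreover have "A * x = B * (q * x)" using AB by (simp add: q_def)
    ultimately show False using ne[of x "q * x"] by (simp add: n A_def B_def)
  qed
  hence "Re q = - norm q" using abs_Re_le_cmod[of q] by linarith
  hence "q = of_real (- norm q)"
    using cmod_power2[of q] by (simp add: complex_eq_iff)
  hence "A = of_real (- norm q) * B" using AB by (simp add: q_def field_simps)
  thus "\<exists>t<0. \<zeta>1 * fprime d a \<zeta>1 = of_real t * (\<zeta>2 * fprime d a \<zeta>2)"
    using q0 by (intro exI[of _ "- norm q"]) (auto simp: A_def B_def n fp)
qed

section \<open>Critical points and cusps\<close>

definition critpoly :: "nat \<Rightarrow> (nat \<Rightarrow> complex) \<Rightarrow> complex poly" where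
  "critpoly d a = monom 1 (Suc d) - (\<Sum>k=1..d. monom (of_nat k * a k) (d - k))"

lemma poly_critpoly:
  assumes "z \<noteq> 0"
  shows "poly (critpoly d a) z = z ^ Suc d * fprime d a z"
proof -
  have "of_nat k * a k * z ^ (d - k) = z ^ Suc d * (of_nat k * a k / z ^ Suc k)" if "k \<in> {1..d}" for k
  proof -
    have "z ^ Suc d = z ^ (d - k) * z ^ Suc k" using that by (simp flip: power_add)
    thus ?thesis using assms by simp
  qed
  thus ?thesis
    by (simp add: critpoly_def fprime_def poly_monom poly_sum right_diff_distrib sum_distrib_left del: power_Suc)
qed

lemma critpoly_lead: "degree (critpoly d a) = Suc d" "lead_coeff (critpoly d a) = 1"
proof -
  have c: "coeff (critpoly d a) j = (if j = Suc d then 1 else 0)" if "j \<ge> Suc d" for j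
  proof -
    have "(\<Sum>k=1..d. coeff (monom (of_nat k * a k) (d - k)) j) = 0"
      using that by (intro sum.neutral) auto
    thus ?thesis by (simp add: critpoly_def coeff_sum)
  qed
  show deg: "degree (critpoly d a) = Suc d"
  proof (rule antisym)
    show "degree (critpoly d a) \<le> Suc d" by (rule degree_le) (use c in auto)
    show "Suc d \<le> degree (critpoly d a)" by (rule le_degree) (use c in auto)
  qed
  show "lead_coeff (critpoly d a) = 1" unfolding deg using c by simp
qed

text \<open>Only the term k = d reaches degree 0, with coefficient - d a_d: here the normalisation
  a_d = -1/d enters.\<close>

lemma poly_critpoly_0:
  assumes "a \<in> Sigma_star d" "d \<ge> 1"
  shows "poly (critpoly d a) 0 = 1"
proof -
  have "(\<Sum>k=1..d. coeff (monom (of_nat k * a k) (d - k)) 0) = (\<Sum>k=1..d. if k = d then of_nat d * a d else 0)"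
    by (intro sum.cong) auto
  also have "\<dots> = -1" using assms by (simp add: Sigma_star_def)
  finally show ?thesis by (simp add: poly_0_coeff_0 critpoly_def coeff_sum)
qed

lemma critpoly_factorization:
  assumes a: "a \<in> Sigma_star d" and d: "d \<ge> 1"
  obtains \<rho> where "\<And>i. i < Suc d \<Longrightarrow> norm (\<rho> i) = 1"
    "\<And>z. poly (critpoly d a) z = (\<Prod>i<Suc d. z - \<rho> i)"
proof -
  obtain \<rho> where \<rho>: "smult (lead_coeff (critpoly d a)) (\<Prod>i<degree (critpoly d a). [:-\<rho> i, 1:]) = critpoly d a"
    by (rule complex_poly_decompose')
  have P: "poly (critpoly d a) z = (\<Prod>i<Suc d. z - \<rho> i)" for z
    by (subst \<rho>[unfolded critpoly_lead(2), unfolded critpoly_lead(1), symmetric])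
       (simp add: poly_prod del: prod.lessThan_Suc)
  have le: "norm (\<rho> i) \<le> 1" if "i < Suc d" for i
  proof (rule ccontr)
    assume "\<not> ?thesis"
    hence g: "norm (\<rho> i) > 1" by simp
    hence "\<rho> i \<noteq> 0" by auto
    moreover have "fprime d a (\<rho> i) \<noteq> 0" using g a by (intro fprime_nonzero) (auto simp: Sigma_star_def)
    ultimately have "poly (critpoly d a) (\<rho> i) \<noteq> 0" by (simp add: poly_critpoly)
    moreover have "poly (critpoly d a) (\<rho> i) = 0"
      unfolding P using that by (intro prod_zero) auto
    ultimately show False by simp
  qed
  have "norm (\<Prod>i<Suc d. 0 - \<rho> i) = 1"
    using poly_critpoly_0[OF assms] unfolding P by simp
  hence pr: "(\<Prod>i<Suc d. norm (\<rho> i)) = 1"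
    unfolding prod_norm[symmetric] by simp
  have "norm (\<rho> i) = 1" if i: "i < Suc d" for i
  proof -
    have "1 = norm (\<rho> i) * (\<Prod>j\<in>{..<Suc d} - {i}. norm (\<rho> j))"
      using pr i by (subst prod.remove[symmetric]) auto
    also have "\<dots> \<le> norm (\<rho> i) * 1"
      by (intro mult_left_mono prod_le_1) (use le in auto)
    finally show ?thesis using le[OF i] by simp
  qed
  thus ?thesis using that P by blast
qed

text \<open>The velocity of $f(e^{it})$ is $i e^{-i\omega t}$ times \<open>tanfac d a t\<close>, where $\omega$ is \<open>freq d\<close>.\<close>

definition freq :: "nat \<Rightarrow> real" where "freq d = (real d - 1) / 2"

definition tanfac :: "nat \<Rightarrow> (nat \<Rightarrow> complex) \<Rightarrow> real \<Rightarrow> complex" where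
  "tanfac d a t = cis ((freq d + 1) * t) * fprime d a (cis t)"

text \<open>The factor in \<open>tanfac\<close> is a square root of \<zeta>^(d+1), chosen through
  the angle. For even d it changes sign when t grows by 2 pi, which is why the tangential factor is
  a function of t and not of the point.\<close>

lemma cis_freq_square: "cis ((freq d + 1) * t) * cis ((freq d + 1) * t) = cis t ^ Suc d"
proof -
  have "(freq d + 1) * t + (freq d + 1) * t = real (Suc d) * t"
    by (simp add: freq_def add_divide_distrib algebra_simps)
  thus ?thesis by (simp only: Complex.DeMoivre cis_mult)
qed

text \<open>On the circle a root \<rho> of modulus 1 satisfies cnj (\<zeta> - \<rho>) \<zeta> = cnj
  (-\<rho>) (\<zeta> - \<rho>). Multiplying over all roots gives self-inversiveness with the
  conjugate constant term, which is 1, as factor; division by a square root of \<zeta>^(d+1) turns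
  it into reality.\<close>

lemma tanfac_real:
  assumes "a \<in> Sigma_star d" "d \<ge> 1"
  shows "Im (tanfac d a t) = 0"
proof -
  from critpoly_factorization[OF assms] obtain \<rho> where \<rho>: "\<And>i. i < Suc d \<Longrightarrow> norm (\<rho> i) = 1"
    and P: "\<And>z. poly (critpoly d a) z = (\<Prod>i<Suc d. z - \<rho> i)" by metis
  define \<zeta> where "\<zeta> = cis t"
  have cn: "cnj z * z = 1" if "norm z = 1" for z
    using that complex_norm_square[of z] by (simp add: mult.commute)
  have \<zeta>: "cnj \<zeta> * \<zeta> = 1" "\<zeta> \<noteq> 0" by (auto simp: \<zeta>_def cn)
  have "cnj (poly (critpoly d a) \<zeta>) * \<zeta> ^ Suc d = (\<Prod>i<Suc d. cnj (\<zeta> - \<rho> i) * \<zeta>)"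
    by (simp add: P prod.distrib del: prod.lessThan_Suc)
  also have "\<dots> = (\<Prod>i<Suc d. cnj (0 - \<rho> i) * (\<zeta> - \<rho> i))"
  proof (rule prod.cong)
    fix i assume "i \<in> {..<Suc d}"
    hence "cnj (\<rho> i) * \<rho> i = 1" using \<rho> cn by auto
    thus "cnj (\<zeta> - \<rho> i) * \<zeta> = cnj (0 - \<rho> i) * (\<zeta> - \<rho> i)"
      using \<zeta> by (simp add: algebra_simps)
  qed simp
  also have "\<dots> = cnj (poly (critpoly d a) 0) * poly (critpoly d a) \<zeta>"
    by (simp add: P prod.distrib del: prod.lessThan_Suc diff_0)
  also have "\<dots> = poly (critpoly d a) \<zeta>" using poly_critpoly_0[OF assms] by simp
  finally have "cnj (\<zeta> ^ Suc d * fprime d a \<zeta>) * \<zeta> ^ Suc d = \<zeta> ^ Suc d * fprime d a \<zeta>"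
    by (simp add: poly_critpoly \<zeta> del: power_Suc)
  moreover have "cnj (\<zeta> ^ Suc d) * \<zeta> ^ Suc d = 1"
    using \<zeta>(1) by (simp flip: power_mult_distrib del: power_Suc)
  ultimately have f: "cnj (fprime d a \<zeta>) = \<zeta> ^ Suc d * fprime d a \<zeta>"
    by (metis complex_cnj_mult mult.assoc mult.commute mult.right_neutral)
  define c where "c = cis ((freq d + 1) * t)"
  have c: "c * c = \<zeta> ^ Suc d" "cnj c * c = 1"
    unfolding c_def \<zeta>_def by (rule cis_freq_square) (simp add: cn)
  have "cnj (tanfac d a t) = (cnj c * c) * c * fprime d a \<zeta>"
    unfolding tanfac_def c_def[symmetric] \<zeta>_def[symmetric] by (simp add: f c(1)[symmetric] del: power_Suc)
  also have "\<dots> = tanfac d a t" unfolding c(2) by (simp add: tanfac_def c_def \<zeta>_def)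
  finally show ?thesis by (simp add: complex_eq_iff)
qed

lemma card_critical:
  assumes a: "a \<in> Sigma_star d" and d: "d \<ge> 1"
  shows "finite {z. norm z = 1 \<and> fprime d a z = 0}" "card {z. norm z = 1 \<and> fprime d a z = 0} = Suc d"
proof -
  let ?P = "critpoly d a"
  have aS: "a \<in> Sigma_d d" using a by (simp add: Sigma_star_def)
  from critpoly_factorization[OF assms] obtain \<rho> where \<rho>: "\<And>i. i < Suc d \<Longrightarrow> norm (\<rho> i) = 1"
    and P: "\<And>z. poly ?P z = (\<Prod>i<Suc d. z - \<rho> i)" by metis
  have T: "norm z = 1" if "poly ?P z = 0" for z
    using that \<rho> unfolding P by (auto simp del: prod.lessThan_Suc)
  have set: "{z. norm z = 1 \<and> fprime d a z = 0} = {z. poly ?P z = 0}"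
  proof (intro equalityI subsetI; clarify)
    fix z assume "norm z = 1" "fprime d a z = 0"
    moreover from this have "z \<noteq> 0" by auto
    ultimately show "poly ?P z = 0" by (simp add: poly_critpoly)
  next
    fix z assume z: "poly ?P z = 0"
    hence "norm z = 1" by (rule T)
    moreover from this have "z \<noteq> 0" by auto
    ultimately show "norm z = 1 \<and> fprime d a z = 0" using z poly_critpoly[of z d a] by simp
  qed
  have P0: "?P \<noteq> 0" using critpoly_lead[of d a] by auto
  show "finite {z. norm z = 1 \<and> fprime d a z = 0}" unfolding set by (rule poly_roots_finite[OF P0])
  \<comment> \<open>A multiple root would make the second derivative vanish at a critical point; a
    squarefree polynomial has as many roots as its degree d + 1.\<close>
  have "rsquarefree ?P"
    unfolding rsquarefree_roots
  proof safe
    fix z assume z: "poly ?P z = 0" "poly (pderiv ?P) z = 0"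
    have z1: "norm z = 1" "fprime d a z = 0" using z(1) set by blast+
    have z0: "z \<noteq> 0" using z1 by auto
    obtain c where c: "c \<noteq> 0" "(fprime d a has_field_derivative c) (at z)"
      using simple_critical_point[OF aS z1] by auto
    have "((\<lambda>z. z ^ Suc d * fprime d a z) has_field_derivative z ^ Suc d * c) (at z)"
      using z1 by (auto intro!: derivative_eq_intros c simp del: power_Suc)
    hence "(poly ?P has_field_derivative z ^ Suc d * c) (at z)"
      by (rule has_field_derivative_transform_within_open[where S = "- {0}"])
         (use z0 in \<open>auto simp: poly_critpoly simp del: power_Suc\<close>)
    hence "poly (pderiv ?P) z = z ^ Suc d * c"
      using poly_DERIV DERIV_unique by blast
    thus False using z c z0 by simp
  qed
  from complex_poly_decompose_rsquarefree[OF this]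
  have "degree ?P = degree (\<Prod>z | poly ?P z = 0. [:- z, 1:])"
    by (metis P0 degree_smult_eq leading_coeff_0_iff)
  also have "\<dots> = card {z. poly ?P z = 0}"
    by (subst degree_prod_sum_eq) auto
  finally show "card {z. norm z = 1 \<and> fprime d a z = 0} = Suc d"
    unfolding set by (simp add: critpoly_lead)
qed

text \<open>Two critical points with one image would form a double point, where the derivative is
  nonzero; so counting critical points counts cusps.\<close>

lemma cusps_card:
  assumes a: "a \<in> Sigma_star d" and d: "d \<ge> 1"
  shows "finite (cusps d a)" "card (cusps d a) = d + 1"
proof -
  let ?C = "{z. norm z = 1 \<and> fprime d a z = 0}"
  have aS: "a \<in> Sigma_d d" using a by (simp add: Sigma_star_def)
  have eq: "cusps d a = fpoly d a ` ?C"
  proof -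
    have "deriv (fpoly d a) z = fprime d a z" if "norm z = 1" for z
      using that by (intro deriv_fpoly) auto
    thus ?thesis unfolding cusps_def by auto
  qed
  have "inj_on (fpoly d a) ?C"
    using double_point_tangency(1)[OF aS] by (auto intro!: inj_onI)
  thus "finite (cusps d a)" "card (cusps d a) = d + 1"
    unfolding eq using card_critical[OF assms] by (auto simp: card_image)
qed

section \<open>The divided difference on the bidisc\<close>

text \<open>In the coordinates $u = 1/z$, $v = 1/w$ this is $(f(z) - f(w))/(z - w)$, which is polynomial; on the
  diagonal it is $f'$.\<close>

definition ddiff :: "nat \<Rightarrow> (nat \<Rightarrow> complex) \<Rightarrow> complex \<Rightarrow> complex \<Rightarrow> complex" where
  "ddiff d a u v = 1 - u * v * (\<Sum>k=1..d. a k * (\<Sum>i<k. v ^ (k - Suc i) * u ^ i))"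

lemma ddiff_eq:
  assumes "u \<noteq> 0" "v \<noteq> 0"
  shows "fpoly d a (inverse u) - fpoly d a (inverse v) = (v - u) / (u * v) * ddiff d a u v"
proof -
  have "fpoly d a (inverse u) - fpoly d a (inverse v)
      = (inverse u - inverse v) + (\<Sum>k=1..d. a k * (u ^ k - v ^ k))"
    by (simp add: fpoly_def power_inverse divide_inverse sum_subtractf right_diff_distrib)
  also have "inverse u - inverse v = (v - u) / (u * v)" using assms by (simp add: field_simps)
  also have "(\<Sum>k=1..d. a k * (u ^ k - v ^ k)) = (u - v) * (\<Sum>k=1..d. a k * (\<Sum>i<k. v ^ (k - Suc i) * u ^ i))"
    by (simp add: power_diff_sumr2 sum_distrib_left mult_ac)
  also have "(v - u) / (u * v) + (u - v) * (\<Sum>k=1..d. a k * (\<Sum>i<k. v ^ (k - Suc i) * u ^ i)) =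
     (v - u) / (u * v) * ddiff d a u v"
    using assms unfolding ddiff_def by (simp add: field_simps)
  finally show ?thesis .
qed

lemma ddiff_commute: "ddiff d a u v = ddiff d a v u"
proof -
  have "(\<Sum>i<k. v ^ (k - Suc i) * u ^ i) = (\<Sum>i<k. u ^ (k - Suc i) * v ^ i)" for k
    by (subst sum.nat_diff_reindex[symmetric]) (auto intro!: sum.cong simp: mult.commute)
  thus ?thesis by (simp add: ddiff_def mult.commute)
qed

lemma ddiff_diag:
  assumes "u \<noteq> 0"
  shows "ddiff d a u u = fprime d a (inverse u)"
proof -
  have "u * u * (a k * (\<Sum>i<k. u ^ (k - Suc i) * u ^ i)) = of_nat k * a k / inverse u ^ Suc k"
    if "k \<in> {1..d}" for k
  proof -
    have "(\<Sum>i<k. u ^ (k - Suc i) * u ^ i) = (\<Sum>i<k. u ^ (k - 1))"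
      by (intro sum.cong) (auto simp flip: power_add)
    moreover have "u ^ k = u * u ^ (k - 1)" using that by (cases k) auto
    ultimately show ?thesis by (simp add: power_inverse divide_inverse)
  qed
  thus ?thesis by (simp add: ddiff_def fprime_def sum_distrib_left)
qed

text \<open>The value 0 stands for the point at infinity. The value 1 there shows that a slice is
  not identically zero, as the applications of Hurwitz's theorem demand.\<close>

lemma ddiff_0 [simp]: "ddiff d a 0 v = 1" "ddiff d a u 0 = 1"
  by (simp_all add: ddiff_def)

lemma continuous_on_ddiff [continuous_intros]:
  assumes "\<And>k. continuous_on S (\<lambda>x. a x k)" "continuous_on S u" "continuous_on S v"
  shows "continuous_on S (\<lambda>x. ddiff d (a x) (u x) (v x))"
  unfolding ddiff_def by (intro continuous_intros assms)

lemma ddiff_holomorphic [holomorphic_intros]: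
  assumes "u holomorphic_on S" "v holomorphic_on S"
  shows "(\<lambda>x. ddiff d a (u x) (v x)) holomorphic_on S"
  unfolding ddiff_def by (intro holomorphic_intros assms)

lemma ddiff_eq_0_iff:
  assumes "u \<noteq> 0" "v \<noteq> 0" "u \<noteq> v"
  shows "ddiff d a u v = 0 \<longleftrightarrow> fpoly d a (inverse u) = fpoly d a (inverse v)"
  using ddiff_eq[of u v d a] assms by auto

lemma ddiff_nonzero_interior:
  assumes a: "a \<in> Sigma_d d" and uv: "norm u < 1" "norm v < 1"
  shows "ddiff d a u v \<noteq> 0"
proof (cases "u = 0 \<or> v = 0")
  case False
  hence ext: "inverse u \<in> {z. 1 < norm z}" "inverse v \<in> {z. 1 < norm z}"
    using uv by (auto simp: norm_inverse one_less_inverse)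
  show ?thesis
  proof (cases "u = v")
    case True
    thus ?thesis using ddiff_diag[of u d a] fprime_nonzero[OF a, of "inverse u"] False ext by auto
  next
    case ne: False
    have "fpoly d a (inverse u) \<noteq> fpoly d a (inverse v)"
      using a ext ne unfolding Sigma_d_def by (auto dest: inj_onD)
    thus ?thesis using False ne by (simp add: ddiff_eq_0_iff)
  qed
qed auto

section \<open>Hurwitz's theorem along slices, and the zeros on the closed bidisc\<close>

lemma slice_uniform_limit:
  fixes h :: "'a::metric_space \<times> 'b::metric_space \<Rightarrow> 'c::metric_space"
  assumes "continuous_on (U \<times> K) h" "compact K" "x0 \<in> U" "\<And>n. x n \<in> U" "x \<longlonglongrightarrow> x0"
  shows "uniform_limit K (\<lambda>n t. h (x n, t)) (\<lambda>t. h (x0, t)) sequentially"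
proof (rule uniform_limitI)
  fix e :: real assume e: "e > 0"
  obtain X0 where X0: "x0 \<in> X0" "open X0" "\<forall>y\<in>X0 \<inter> U. \<forall>t\<in>K. dist (h (y, t)) (h (x0, t)) \<le> e / 2"
  proof (rule continuous_on_prod_compactE[OF assms(1,2,3)])
    show "0 < e / 2" using e by simp
  qed
  have "\<forall>\<^sub>F n in sequentially. x n \<in> X0" using X0 assms(5) by (auto dest: topological_tendstoD)
  thus "\<forall>\<^sub>F n in sequentially. \<forall>t\<in>K. dist (h (x n, t)) (h (x0, t)) < e"
  proof eventually_elim
    case (elim n)
    show ?case
    proof
      fix t assume "t \<in> K"
      hence "dist (h (x n, t)) (h (x0, t)) \<le> e / 2" using X0(3) elim assms(4) by blast
      thus "dist (h (x n, t)) (h (x0, t)) < e" using e by linarith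
    qed
  qed
qed

text \<open>Hurwitz's theorem covers a nonconstant limit slice; a constant one takes its value at p,
  by continuity up to the closed disc. The point p may lie on the circle, which the homotopy
  argument exploits.\<close>

lemma Hurwitz_slice_nonzero:
  fixes h :: "'a::metric_space \<times> complex \<Rightarrow> complex"
  assumes "continuous_on (U \<times> cball 0 1) h" "x0 \<in> U" "\<And>n. x n \<in> U" "x \<longlonglongrightarrow> x0"
    and hol: "\<And>y. y \<in> U \<Longrightarrow> (\<lambda>t. h (y, t)) holomorphic_on ball 0 1"
    and nz: "\<And>n t. norm t < 1 \<Longrightarrow> h (x n, t) \<noteq> 0"
    and p: "norm p \<le> 1" "h (x0, p) \<noteq> 0" and t: "norm t < 1"
  shows "h (x0, t) \<noteq> 0"
proof (cases "(\<lambda>t. h (x0, t)) constant_on ball 0 1")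
  case True
  then obtain c where c: "\<And>t. t \<in> ball 0 1 \<Longrightarrow> h (x0, t) = c" unfolding constant_on_def by auto
  have "h (x0, p) = c"
  proof (rule continuous_constant_on_closure[of "ball 0 1" "\<lambda>t. h (x0, t)"])
    have "continuous_on (cball 0 1) (\<lambda>t. h (x0, t))"
      by (rule continuous_on_compose2[OF assms(1)]) (use assms(2) in \<open>auto intro!: continuous_intros\<close>)
    thus "continuous_on (closure (ball 0 1)) (\<lambda>t. h (x0, t))" by simp
    show "h (x0, t) = c" if "t \<in> ball 0 1" for t using that by (rule c)
    show "p \<in> closure (ball 0 1)" using p by simp
  qed
  moreover have "h (x0, t) = c" using t by (intro c) simp
  ultimately show ?thesis using p by simp
next
  case False
  show ?thesis
  proof (rule Hurwitz_no_zeros[where S = "ball 0 1" and \<F> = "\<lambda>n t. h (x n, t)" and g = "\<lambda>t. h (x0, t)"])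
    show "uniform_limit K (\<lambda>n t. h (x n, t)) (\<lambda>t. h (x0, t)) sequentially" if "compact K" "K \<subseteq> ball 0 1" for K
    proof (rule slice_uniform_limit[OF _ that(1) assms(2,3,4)])
      show "continuous_on (U \<times> K) h"
        by (rule continuous_on_subset[OF assms(1)]) (use that in auto)
    qed
    show "open (ball 0 (1::real) :: complex set)" "connected (ball 0 (1::real) :: complex set)" "t \<in> ball 0 1"
      using t by auto
    show "(\<lambda>t. h (x n, t)) holomorphic_on ball 0 1" for n by (rule hol[OF assms(3)])
    show "(\<lambda>t. h (x0, t)) holomorphic_on ball 0 1" by (rule hol[OF assms(2)])
    show "\<not> (\<lambda>t. h (x0, t)) constant_on ball 0 1" by (rule False)
    show "h (x n, z) \<noteq> 0" if "z \<in> ball 0 1" for n z using that by (intro nz) auto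
  qed
qed

text \<open>Contracting u by n / (n + 1) moves it into the open disc, where univalence applies, and
  the limit slice is 1 at v = 0. By symmetry all zeros in the closed bidisc lie on the
  torus.\<close>

lemma ddiff_nonzero_mixed:
  assumes a: "a \<in> Sigma_d d" and uv: "norm u \<le> 1" "norm v < 1"
  shows "ddiff d a u v \<noteq> 0"
proof -
  have "(\<lambda>p. ddiff d a (fst p) (snd p)) (u, v) \<noteq> 0"
  proof (rule Hurwitz_slice_nonzero[where U = UNIV and x = "\<lambda>n. of_real (real n / real (Suc n)) * u" and p = 0])
    show "continuous_on (UNIV \<times> cball 0 1) (\<lambda>p. ddiff d a (fst p) (snd p))"
      by (intro continuous_intros)
    have "(\<lambda>n. of_real (real n / real (Suc n)) * u) \<longlonglongrightarrow> of_real 1 * u"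
      by (intro tendsto_intros LIMSEQ_n_over_Suc_n)
    thus "(\<lambda>n. of_real (real n / real (Suc n)) * u) \<longlonglongrightarrow> u" by simp
    show "(\<lambda>t. ddiff d a (fst (y, t)) (snd (y, t))) holomorphic_on ball 0 1" for y
      by (simp, intro holomorphic_intros)
    show "ddiff d a (fst (of_real (real n / real (Suc n)) * u, t)) (snd (of_real (real n / real (Suc n)) * u, t)) \<noteq> 0"
      if "norm t < 1" for n t
    proof -
      have "norm (of_real (real n / real (Suc n)) * u) = real n / real (Suc n) * norm u"
        by (simp add: norm_mult del: of_nat_Suc of_real_divide)
      also have "\<dots> \<le> real n / real (Suc n) * 1" using uv by (intro mult_left_mono) auto
      also have "\<dots> < 1" by simp
      finally show ?thesis using ddiff_nonzero_interior[OF a _ that] by (simp only: fst_conv snd_conv not_False_eq_True)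
    qed
  qed (use uv in auto)
  thus ?thesis by simp
qed

lemma strictly_inside_segment:
  fixes u v :: complex
  assumes "norm u \<le> 1" "norm v \<le> 1" "u \<noteq> v" "0 < s" "s < 1"
  shows "norm ((1 - s) *\<^sub>R u + s *\<^sub>R v) < 1"

proof -
  have "(1 - s) *\<^sub>R u + s *\<^sub>R v \<in> open_segment u v"
    using assms by (auto simp: in_segment)
  from dist_decreases_open_segment[OF this, of 0] show ?thesis
    using assms by auto
qed

section \<open>Double points do not cross\<close>

text \<open>1 - e^(it) = 2 sin(t/2) e^(i(t - pi)/2), and (t - pi)/2 is a principal argument.\<close>

lemma Ln_one_minus_cis:
  assumes "0 < t" "t < 2 * pi"
  shows "Ln (1 - cis t) = Complex (ln (2 * sin (t / 2))) ((t - pi) / 2)"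
proof (rule Ln_unique)
  have s: "sin (t / 2) > 0" using assms by (intro sin_gt_zero) auto
  have "cis ((t - pi) / 2) = cis (t / 2) * cis (- (pi / 2))"
    by (simp only: cis_mult diff_divide_distrib) simp
  also have "\<dots> = Complex (sin (t / 2)) (- cos (t / 2))"
    by (simp add: complex_eq_iff)
  finally have c: "cis ((t - pi) / 2) = Complex (sin (t / 2)) (- cos (t / 2))" .
  have "exp (Complex (ln (2 * sin (t / 2))) ((t - pi) / 2)) = of_real (2 * sin (t / 2)) * cis ((t - pi) / 2)"
    using s by (simp add: exp_eq_polar)
  also have "\<dots> = 1 - cis t"
    unfolding c using sin_double[of "t / 2"] cos_double_sin[of "t / 2"]
    by (simp add: complex_eq_iff power2_eq_square)
  finally show "exp (Complex (ln (2 * sin (t / 2))) ((t - pi) / 2)) = 1 - cis t" .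
qed (use assms in auto)

text \<open>A sawtooth in t, linear on each period with a jump of 2 pi i at multiples of 2 pi; the
  jump is what detects the cyclic order of points on the circle.\<close>

lemma Ln_one_minus_cis_diff:
  assumes "0 < t" "t < 2 * pi"
  shows "Ln (1 - cis t) - Ln (1 - cis (- t)) = \<i> * of_real (t - pi)"
proof -
  have c: "cis (- t) = cis (2 * pi - t)" by (simp add: complex_eq_iff cos_diff sin_diff)
  show ?thesis
    unfolding c using Ln_one_minus_cis[OF assms] Ln_one_minus_cis[of "2 * pi - t"] assms
    by (simp add: complex_eq_iff diff_divide_distrib)
qed

lemma one_minus_not_nonpos:
  fixes A v :: complex
  assumes "norm A = 1" "norm v \<le> 1" "v \<noteq> A"
  shows "1 - v / A \<notin> \<real>\<^sub>\<le>\<^sub>0"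
proof
  assume "1 - v / A \<in> \<real>\<^sub>\<le>\<^sub>0"
  hence h: "Re (v / A) \<ge> 1" "Im (v / A) = 0" by (auto simp: complex_nonpos_Reals_iff)
  have n: "norm (v / A) \<le> 1" using assms by (simp add: norm_divide)
  hence "Re (v / A) = 1" using h complex_Re_le_cmod[of "v / A"] by linarith
  hence "v / A = 1" using h by (simp add: complex_eq_iff)
  thus False using assms by (auto simp: field_simps)
qed

text \<open>The combination is a continuous logarithm of 1 on the connected set W, hence has values
  in the discrete set of multiples of 2 pi i. The principal logarithms are continuous since 1 - v/A
  and 1 - v/B avoid the closed negative axis.\<close>

lemma log_ratio_constant:
  assumes W: "connected W" "C \<in> W" "E \<in> W" and AB: "norm A = 1" "norm B = 1"
    and g: "continuous_on W g" "continuous_on W h"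
    and eq: "\<And>v. v \<in> W \<Longrightarrow> exp (g v) * (1 - v / A) = exp (h v) * (1 - v / B)"
    and Wn: "\<And>v. v \<in> W \<Longrightarrow> norm v \<le> 1 \<and> v \<noteq> A \<and> v \<noteq> B"
  shows "g C + Ln (1 - C / A) - h C - Ln (1 - C / B) = g E + Ln (1 - E / A) - h E - Ln (1 - E / B)"
proof -
  define K where "K = (\<lambda>v. g v + Ln (1 - v / A) - h v - Ln (1 - v / B))"
  have np: "1 - v / A \<notin> \<real>\<^sub>\<le>\<^sub>0" "1 - v / B \<notin> \<real>\<^sub>\<le>\<^sub>0" if "v \<in> W" for v
    using one_minus_not_nonpos AB Wn[OF that] by auto
  have nz: "1 - v / A \<noteq> 0" "1 - v / B \<noteq> 0" if "v \<in> W" for v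
    using np[OF that] by auto
  have A0: "A \<noteq> 0" "B \<noteq> 0" using AB by auto
  have contK: "continuous_on W K"
    unfolding K_def using np A0 by (intro continuous_intros g) auto
  have e1: "exp (K v) = 1" if "v \<in> W" for v
  proof -
    have "exp (K v) = (exp (g v) * (1 - v / A)) / (exp (h v) * (1 - v / B))"
      using nz[OF that] by (simp add: K_def exp_add exp_diff)
    thus ?thesis using eq[OF that] nz[OF that] by simp
  qed
  have "K constant_on W"
  proof (rule continuous_discrete_range_constant[OF W(1) contK])
    fix x assume x: "x \<in> W"
    show "\<exists>e>0. \<forall>y. y \<in> W \<and> K y \<noteq> K x \<longrightarrow> e \<le> norm (K y - K x)"
    proof (intro exI[of _ 1] conjI allI impI)
      fix y assume y: "y \<in> W \<and> K y \<noteq> K x"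
      have "exp (K y - K x) = 1" using e1 x y by (simp add: exp_diff)
      then obtain n :: int where n: "Re (K y - K x) = 0" "Im (K y - K x) = of_int (2 * n) * pi"
        unfolding exp_eq_1 by auto
      have "n \<noteq> 0" using n y by (auto simp: complex_eq_iff)
      hence "1 \<le> \<bar>real_of_int n\<bar>" by linarith
      moreover have "1 * 1 \<le> \<bar>real_of_int n\<bar> * (2 * pi)"
        using calculation pi_gt3 by (intro mult_mono) auto
      moreover have "\<bar>Im (K y - K x)\<bar> = \<bar>real_of_int n\<bar> * (2 * pi)"
        unfolding n by (simp add: abs_mult)
      ultimately show "1 \<le> norm (K y - K x)"
        using abs_Im_le_cmod[of "K y - K x"] by linarith
    qed simp
  qed
  hence "K C = K E" using W unfolding constant_on_def by metis
  thus ?thesis by (simp add: K_def)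
qed

text \<open>Strict convexity of the disc: interior points of a segment between different points of
  the closed disc lie in the open disc.\<close>

lemma convex_ball_Un:
  fixes X :: "complex set"
  assumes "X \<subseteq> cball 0 1"
  shows "convex (ball 0 1 \<union> X)"
  unfolding convex_alt
proof (intro ballI allI impI)
  fix x y and u :: real
  assume xy: "x \<in> ball 0 1 \<union> X" "y \<in> ball 0 1 \<union> X" and u: "0 \<le> u \<and> u \<le> 1"
  show "(1 - u) *\<^sub>R x + u *\<^sub>R y \<in> ball 0 1 \<union> X"
  proof (cases "x = y \<or> u = 0 \<or> u = 1")
    case True
    thus ?thesis using xy by (auto simp: scaleR_left_distrib[symmetric] simp del: scaleR_left_diff_distrib simp flip: scaleR_add_left)
  next
    case False
    have "norm x \<le> 1" "norm y \<le> 1" using xy assms by auto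
    hence "norm ((1 - u) *\<^sub>R x + u *\<^sub>R y) < 1"
      using False u by (intro strictly_inside_segment) auto
    thus ?thesis by auto
  qed
qed

text \<open>Strictly between two different points of the closed bidisc at least one coordinate lies
  in the open disc, and there no zero occurs.\<close>

lemma convex_ddiff_nonzero:
  assumes a: "a \<in> Sigma_d d"
  shows "convex {p. norm (fst p) \<le> 1 \<and> norm (snd p) \<le> 1 \<and> ddiff d a (fst p) (snd p) \<noteq> 0}" (is "convex ?S")
  unfolding convex_alt
proof (intro ballI allI impI)
  fix x y and u :: real
  assume xy: "x \<in> ?S" "y \<in> ?S" and u: "0 \<le> u \<and> u \<le> 1"
  define z where "z = (1 - u) *\<^sub>R x + u *\<^sub>R y"
  have fs: "fst z = (1 - u) *\<^sub>R fst x + u *\<^sub>R fst y" "snd z = (1 - u) *\<^sub>R snd x + u *\<^sub>R snd y"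
    by (simp_all add: z_def)
  have cv: "fst z \<in> cball 0 1" "snd z \<in> cball 0 1"
    unfolding fs using xy u convex_cball[of "0::complex" 1] unfolding convex_alt
    by (metis (no_types, lifting) mem_Collect_eq mem_cball_0)+
  have "z \<in> ?S"
  proof (cases "x = y \<or> u = 0 \<or> u = 1")
    case True
    hence "z = x \<or> z = y" by (auto simp: z_def simp flip: scaleR_add_left)
    thus ?thesis using xy by auto
  next
    case False
    hence "fst x \<noteq> fst y \<or> snd x \<noteq> snd y" by (auto simp: prod_eq_iff)
    hence "norm (fst z) < 1 \<or> norm (snd z) < 1"
      unfolding fs using strictly_inside_segment xy False u by auto
    thus ?thesis
      using cv ddiff_nonzero_mixed[OF a, of "fst z" "snd z"] ddiff_nonzero_mixed[OF a, of "snd z" "fst z"]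
      by (auto simp: ddiff_commute[of d a "snd z"])
  qed
  thus "(1 - u) *\<^sub>R x + u *\<^sub>R y \<in> ?S" by (simp add: z_def)
qed

text \<open>For nonzero v both sides equal - v (f(1/A) - f(1/v)), which sees A only through
  f(1/A).\<close>

lemma ddiff_double_pair:
  assumes "A \<noteq> 0" "B \<noteq> 0" "fpoly d a (inverse A) = fpoly d a (inverse B)"
  shows "ddiff d a A v * (1 - v / A) = ddiff d a B v * (1 - v / B)"
proof (cases "v = 0")
  case False
  have *: "ddiff d a C v * (1 - v / C) = - (v * (fpoly d a (inverse C) - fpoly d a (inverse v)))" if "C \<noteq> 0" for C
    using ddiff_eq[OF that False, of d a] that False by (simp add: field_simps)
  show ?thesis unfolding *[OF assms(1)] *[OF assms(2)] assms(3) ..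
qed auto

text \<open>The set of zero-free points of the closed bidisc is convex because zeros can occur only on the torus, so the
  divided difference has a continuous logarithm $G$ on it. For $f(1/A) = f(1/B)$ the quotient of the
  divided differences at $(A, v)$ and $(B, v)$ is $(1 - v/B)/(1 - v/A)$, which determines the increments
  of $G$ up to an additive constant; comparing both ways around the rectangle with corners
  $A, B$ and $C, E$ gives the identity.\<close>

lemma double_pairs_log_identity:
  assumes a: "a \<in> Sigma_d d" and n: "norm A = 1" "norm B = 1" "norm C = 1" "norm E = 1"
    and AB: "fpoly d a (inverse A) = fpoly d a (inverse B)"
    and CE: "fpoly d a (inverse C) = fpoly d a (inverse E)"
    and ne: "fpoly d a (inverse A) \<noteq> fpoly d a (inverse C)"
  shows "(Ln (1 - C / A) - Ln (1 - A / C)) - (Ln (1 - C / B) - Ln (1 - B / C))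
       - (Ln (1 - E / A) - Ln (1 - A / E)) + (Ln (1 - E / B) - Ln (1 - B / E)) = 0"
proof -
  define S where "S = {p. norm (fst p) \<le> 1 \<and> norm (snd p) \<le> 1 \<and> ddiff d a (fst p) (snd p) \<noteq> 0}"
  have ctr: "contractible S"
    unfolding S_def using convex_imp_contractible[OF convex_ddiff_nonzero[OF a]] .
  have con: "continuous_on S (\<lambda>p. ddiff d a (fst p) (snd p))" by (intro continuous_intros)
  have "ddiff d a (fst p) (snd p) \<noteq> 0" if "p \<in> S" for p using that by (simp add: S_def)
  from continuous_logarithm_on_contractible[OF con ctr this] obtain G where G: "continuous_on S G" "\<And>p. p \<in> S \<Longrightarrow> ddiff d a (fst p) (snd p) = exp (G p)"
    by metis
  have nz: "A \<noteq> 0" "B \<noteq> 0" "C \<noteq> 0" "E \<noteq> 0" using n by auto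
  have dist: "A \<noteq> C" "A \<noteq> E" "B \<noteq> C" "B \<noteq> E" using ne AB CE by auto
  have dn: "ddiff d a A C \<noteq> 0" "ddiff d a A E \<noteq> 0" "ddiff d a B C \<noteq> 0" "ddiff d a B E \<noteq> 0"
    using dist nz ne AB CE by (simp_all add: ddiff_eq_0_iff)
  have S1: "(X, v) \<in> S" if "X \<in> {A, B}" "v \<in> ball 0 1 \<union> {C, E}" for X v
    using that n dn ddiff_nonzero_mixed[OF a, of X v] by (auto simp: S_def)
  have S2: "(v, X) \<in> S" if "X \<in> {C, E}" "v \<in> ball 0 1 \<union> {A, B}" for X v
    using that n dn ddiff_nonzero_mixed[OF a, of X v] ddiff_commute[of d a X v] by (auto simp: S_def)
  have c1: "continuous_on (ball 0 1 \<union> {C, E}) (\<lambda>v. G (X, v))" if "X \<in> {A, B}" for X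
    by (rule continuous_on_compose2[OF G(1)]) (use S1[OF that] in \<open>auto intro!: continuous_intros\<close>)
  have c2: "continuous_on (ball 0 1 \<union> {A, B}) (\<lambda>v. G (v, X))" if "X \<in> {C, E}" for X
    by (rule continuous_on_compose2[OF G(1)]) (use S2[OF that] in \<open>auto intro!: continuous_intros\<close>)
  have 1: "G (A, C) + Ln (1 - C / A) - G (B, C) - Ln (1 - C / B)
         = G (A, E) + Ln (1 - E / A) - G (B, E) - Ln (1 - E / B)"
  proof (rule log_ratio_constant[where W = "ball 0 1 \<union> {C, E}" and g = "\<lambda>v. G (A, v)" and h = "\<lambda>v. G (B, v)"])
    show "connected (ball 0 1 \<union> {C, E})" using n by (intro convex_connected convex_ball_Un) auto
    show "exp (G (A, v)) * (1 - v / A) = exp (G (B, v)) * (1 - v / B)" if "v \<in> ball 0 1 \<union> {C, E}" for v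
      using G(2)[OF S1[OF _ that, of A]] G(2)[OF S1[OF _ that, of B]] ddiff_double_pair[OF nz(1,2) AB, of v] by simp
  qed (use n c1 dist in auto)
  have 2: "G (A, C) + Ln (1 - A / C) - G (A, E) - Ln (1 - A / E)
         = G (B, C) + Ln (1 - B / C) - G (B, E) - Ln (1 - B / E)"
  proof (rule log_ratio_constant[where W = "ball 0 1 \<union> {A, B}" and g = "\<lambda>v. G (v, C)" and h = "\<lambda>v. G (v, E)"])
    show "connected (ball 0 1 \<union> {A, B})" using n by (intro convex_connected convex_ball_Un) auto
    show "exp (G (v, C)) * (1 - v / C) = exp (G (v, E)) * (1 - v / E)" if "v \<in> ball 0 1 \<union> {A, B}" for v
      using G(2)[OF S2[OF _ that, of C]] G(2)[OF S2[OF _ that, of E]] ddiff_double_pair[OF nz(3,4) CE, of v]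
      by (simp add: ddiff_commute[of d a v])
  qed (use n c2 dist in auto)
  show ?thesis using 1 2 by algebra
qed

text \<open>Interlacing enters through the fact that all four differences lie between 0 and 2 pi,
  which selects the same branch of the sawtooth in every term.\<close>

lemma double_pairs_noncrossing:
  assumes a: "a \<in> Sigma_d d" and ord: "p1 < p2" "p2 < q1" "q1 < q2" "q2 < p1 + 2 * pi"
    and AB: "fpoly d a (cis p1) = fpoly d a (cis q1)"
    and CE: "fpoly d a (cis p2) = fpoly d a (cis q2)"
  shows "fpoly d a (cis p1) = fpoly d a (cis p2)"
proof (rule ccontr)
  assume ne: "fpoly d a (cis p1) \<noteq> fpoly d a (cis p2)"
  have q: "cis (- x) / cis (- y) = cis (y - x)" for x y by (simp add: cis_divide)
  have i: "inverse (cis (- x)) = cis x" for x by (simp add: cis_inverse)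
  have "(Ln (1 - cis (p1 - p2)) - Ln (1 - cis (p2 - p1))) - (Ln (1 - cis (q1 - p2)) - Ln (1 - cis (p2 - q1)))
       - (Ln (1 - cis (p1 - q2)) - Ln (1 - cis (q2 - p1))) + (Ln (1 - cis (q1 - q2)) - Ln (1 - cis (q2 - q1))) = 0"
    using double_pairs_log_identity[OF a, of "cis (- p1)" "cis (- q1)" "cis (- p2)" "cis (- q2)"] AB CE ne
    unfolding q i by simp
  hence "- (Ln (1 - cis (p2 - p1)) - Ln (1 - cis (p1 - p2))) - (Ln (1 - cis (q1 - p2)) - Ln (1 - cis (p2 - q1)))
       + (Ln (1 - cis (q2 - p1)) - Ln (1 - cis (p1 - q2))) - (Ln (1 - cis (q2 - q1)) - Ln (1 - cis (q1 - q2))) = 0"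
    by (simp add: algebra_simps)
  moreover have "Ln (1 - cis (p2 - p1)) - Ln (1 - cis (p1 - p2)) = \<i> * of_real (p2 - p1 - pi)"
    using Ln_one_minus_cis_diff[of "p2 - p1"] ord by simp
  moreover have "Ln (1 - cis (q1 - p2)) - Ln (1 - cis (p2 - q1)) = \<i> * of_real (q1 - p2 - pi)"
    using Ln_one_minus_cis_diff[of "q1 - p2"] ord by simp
  moreover have "Ln (1 - cis (q2 - p1)) - Ln (1 - cis (p1 - q2)) = \<i> * of_real (q2 - p1 - pi)"
    using Ln_one_minus_cis_diff[of "q2 - p1"] ord by simp
  moreover have "Ln (1 - cis (q2 - q1)) - Ln (1 - cis (q1 - q2)) = \<i> * of_real (q2 - q1 - pi)"
    using Ln_one_minus_cis_diff[of "q2 - q1"] ord by simp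
  ultimately have "- (\<i> * of_real (p2 - p1 - pi)) - \<i> * of_real (q1 - p2 - pi)
       + \<i> * of_real (q2 - p1 - pi) - \<i> * of_real (q2 - q1 - pi) = 0"
    by (simp only:)
  \<comment> \<open>The angles cancel and the constants add up to pi + pi - pi + pi. In the order p1
    < q1 < p2 < q2 the second term would be on another branch and the sum would be 0.\<close>
  hence "\<i> * of_real (2 * pi) = 0" by (simp add: algebra_simps)
  thus False by simp
qed

section \<open>The upper bound: counting non-crossing chords of integer span\<close>

lemma noncrossing_intervals_card:
  fixes I :: "(real \<times> real) set"
  assumes "finite I" "a < b"
    and "\<And>p. p \<in> I \<Longrightarrow> a \<le> fst p \<and> fst p < snd p \<and> snd p < b \<and> snd p - fst p \<in> \<int>"
    and "\<And>p q. p \<in> I \<Longrightarrow> q \<in> I \<Longrightarrow> p \<noteq> q \<Longrightarrow>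
           fst p \<noteq> fst q \<and> (fst p < fst q \<longrightarrow> snd q < snd p \<or> snd p < fst q)"
  shows "real (card I) < b - a"
  using assms
proof (induction "card I" arbitrary: I a b rule: less_induct)
  case less
  show ?case
  proof (cases "I = {}")
    case True
    thus ?thesis using less.prems by simp
  next
    case False
    have "Min (fst ` I) \<in> fst ` I" using False less.prems(1) by (intro Min_in) auto
    then obtain p where p: "p \<in> I" "fst p = Min (fst ` I)" by auto
    have min: "fst p \<le> fst q" if "q \<in> I" for q
      using that less.prems(1) p by simp
    \<comment> \<open>As p starts leftmost, every other interval is nested in p or lies to the right
      of it.\<close>
    define J1 where "J1 = {q \<in> I. q \<noteq> p \<and> snd q < snd p}"
    define J2 where "J2 = {q \<in> I. q \<noteq> p \<and> snd p < fst q}"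
    have fin: "finite J1" "finite J2" using less.prems(1) by (auto simp: J1_def J2_def)
    have I: "I = insert p (J1 \<union> J2)"
      using less.prems(4)[OF p(1)] min p(1) unfolding J1_def J2_def by fastforce
    have disj: "J1 \<inter> J2 = {}" "p \<notin> J1 \<union> J2"
      using less.prems(3) unfolding J1_def J2_def by fastforce+
    have card: "card I = Suc (card J1 + card J2)"
      using fin disj by (subst I) (simp add: card_Un_disjoint)
    have "real (card J1) < snd p - fst p"
    proof (rule less.hyps)
      show "card J1 < card I" using card by simp
      fix q assume "q \<in> J1"
      thus "fst p \<le> fst q \<and> fst q < snd q \<and> snd q < snd p \<and> snd q - fst q \<in> \<int>"
        using less.prems(3)[of q] min[of q] by (auto simp: J1_def)
    qed (use fin less.prems(3)[OF p(1)] less.prems(4) in \<open>auto simp: J1_def\<close>)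
    moreover obtain m :: int where m: "snd p - fst p = of_int m"
      using less.prems(3)[OF p(1)] by (auto elim: Ints_cases)
    ultimately have "int (card J1) < m" by linarith
    \<comment> \<open>Since p has integer length, the strict inequality leaves a whole unit, which
      pays for p itself.\<close>
    hence c1: "real (card J1) + 1 \<le> snd p - fst p" unfolding m by linarith
    have c2: "real (card J2) < b - snd p"
    proof (rule less.hyps)
      show "card J2 < card I" using card by simp
      fix q assume "q \<in> J2"
      thus "snd p \<le> fst q \<and> fst q < snd q \<and> snd q < b \<and> snd q - fst q \<in> \<int>"
        using less.prems(3)[of q] by (auto simp: J2_def)
    qed (use fin less.prems(3)[OF p(1)] less.prems(4) in \<open>auto simp: J2_def\<close>)
    show ?thesis using c1 c2 card less.prems(3)[OF p(1)] by simp
  qed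
qed

text \<open>The normal \<zeta> f'(\<zeta>) is cis (- freq d * t) times the real tangential factor,
  so a negative ratio of the normals makes cis (freq d * (y - x)) real. The second claim records the
  sign, that is, that the branches lie on opposite sides of the tangent.\<close>

lemma double_pair_angles:
  assumes a: "a \<in> Sigma_star d" and d: "d \<ge> 1" and ne: "cis x \<noteq> cis y"
    and eq: "fpoly d a (cis x) = fpoly d a (cis y)"
  shows "sin (freq d * (y - x)) = 0"
    "cos (freq d * (y - x)) * Re (tanfac d a x) * Re (tanfac d a y) < 0"
proof -
  have aS: "a \<in> Sigma_d d" using a by (simp add: Sigma_star_def)
  define r1 where "r1 = Re (tanfac d a x)"
  define r2 where "r2 = Re (tanfac d a y)"
  have r: "tanfac d a x = of_real r1" "tanfac d a y = of_real r2"
    using tanfac_real[OF a d] by (simp_all add: r1_def r2_def complex_eq_iff)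
  have id: "cis t * fprime d a (cis t) = cis (- freq d * t) * tanfac d a t" for t
    unfolding tanfac_def mult.assoc[symmetric] cis_mult by (simp add: algebra_simps)
  note dt = double_point_tangency[OF aS _ _ ne eq, simplified]
  obtain t where t: "t < 0" "cis x * fprime d a (cis x) = of_real t * (cis y * fprime d a (cis y))"
    using dt(3) by auto
  have "cis (freq d * y) * (cis (- freq d * x) * of_real r1) = cis (freq d * y) * (of_real t * (cis (- freq d * y) * of_real r2))"
    using t(2) unfolding id r by simp
  moreover have "cis (freq d * y) * (cis (- freq d * x) * of_real r1) = cis (freq d * (y - x)) * of_real r1"
    unfolding mult.assoc[symmetric] cis_mult by (simp add: algebra_simps)
  moreover have "cis (freq d * y) * (of_real t * (cis (- freq d * y) * of_real r2)) = of_real (t * r2)"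
  proof -
    have "cis (freq d * y) * cis (- freq d * y) = 1" unfolding cis_mult by simp
    thus ?thesis by (simp add: mult.left_commute mult.assoc)
  qed
  ultimately have "cis (freq d * (y - x)) * of_real r1 = of_real (t * r2)" by simp
  hence e: "cos (freq d * (y - x)) * r1 = t * r2" "sin (freq d * (y - x)) * r1 = 0"
    by (simp_all add: complex_eq_iff)
  have "tanfac d a x \<noteq> 0" "tanfac d a y \<noteq> 0" using dt(1,2) by (auto simp: tanfac_def)
  hence "r1 \<noteq> 0" "r2 \<noteq> 0" by (auto simp: r)
  thus "sin (freq d * (y - x)) = 0" using e by simp
  have "cos (freq d * (y - x)) * r1 * r2 = t * r2\<^sup>2" by (simp add: e power2_eq_square)
  also have "\<dots> < 0" using t \<open>r2 \<noteq> 0\<close> by (simp add: mult_neg_pos)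
  finally show "cos (freq d * (y - x)) * Re (tanfac d a x) * Re (tanfac d a y) < 0"
    by (simp add: r1_def r2_def)
qed

lemma unit_circle_angle:
  assumes "norm z = 1"
  obtains t where "0 \<le> t" "t < 2 * pi" "z = cis t"
  using Arg2pi[of z] assms that[of "Arg2pi z"] by (auto simp: is_Arg_def cis_conv_exp)

lemma cis_inj_2pi:
  assumes "cis x = cis y" "\<bar>x - y\<bar> < 2 * pi"
  shows "x = y"
proof -
  have "cos (x - y) = 1" using arg_cong[OF assms(1), of "\<lambda>z. Re (z / cis y)"] by (simp add: cis_divide)
  then obtain n :: int where n: "x - y = of_int n * 2 * pi" unfolding cos_one_2pi_int by auto
  hence "\<bar>real_of_int n\<bar> * (2 * pi) < 1 * (2 * pi)" using assms(2) by (simp add: abs_mult)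
  hence "\<bar>real_of_int n\<bar> < 1" using mult_less_cancel_right_pos[of "2 * pi"] pi_gt_zero by simp
  hence "n = 0" by linarith
  thus ?thesis using n by simp
qed

lemma double_point_angles:
  assumes "w \<in> double_points d a"
  obtains x y where "0 \<le> x" "x < y" "y < 2 * pi" "fpoly d a (cis x) = w" "fpoly d a (cis y) = w"
proof -
  from assms obtain z1 z2 where z: "norm z1 = 1" "norm z2 = 1" "z1 \<noteq> z2" "fpoly d a z1 = w" "fpoly d a z2 = w"
    unfolding double_points_def by auto
  obtain x where x: "0 \<le> x" "x < 2 * pi" "z1 = cis x" using unit_circle_angle[OF z(1)] by metis
  obtain y where y: "0 \<le> y" "y < 2 * pi" "z2 = cis y" using unit_circle_angle[OF z(2)] by metis
  have "x \<noteq> y" using z x y by auto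
  thus ?thesis using that[of x y] that[of y x] x y z by (cases "x < y") auto
qed

lemma double_points_card_le:
  assumes a: "a \<in> Sigma_star d" and d: "d \<ge> 2"
  shows "finite (double_points d a) \<and> card (double_points d a) \<le> d - 2"
\<comment> \<open>Finiteness is not known in advance, so every finite set of double points is
  bounded.\<close>
proof (rule finite_if_finite_subsets_card_bdd)
  fix X assume X: "X \<subseteq> double_points d a" "finite X"
  have aS: "a \<in> Sigma_d d" using a by (simp add: Sigma_star_def)
  have "\<forall>w\<in>X. \<exists>p. 0 \<le> fst p \<and> fst p < snd p \<and> snd p < 2 * pi \<and>
          fpoly d a (cis (fst p)) = w \<and> fpoly d a (cis (snd p)) = w"
    using X double_point_angles by (metis fst_conv snd_conv subsetD)
  then obtain P where P: "\<And>w. w \<in> X \<Longrightarrow> 0 \<le> fst (P w) \<and> fst (P w) < snd (P w) \<and> snd (P w) < 2 * pi \<and>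
          fpoly d a (cis (fst (P w))) = w \<and> fpoly d a (cis (snd (P w))) = w"
    by metis
  \<comment> \<open>In this unit the circle has length d - 1 and the spans are integers, because
    freq d * (y - x) is a multiple of pi. The strict bound d - 1 then gives d - 2.\<close>
  define c where "c = freq d / pi"
  have c: "c > 0" using d by (simp add: c_def freq_def)
  have c2: "2 * pi * c = real d - 1" by (simp add: c_def freq_def)
  define Q where "Q = (\<lambda>w. (c * fst (P w), c * snd (P w)))"
  have inj: "inj_on Q X"
    using c P by (intro inj_onI) (metis Pair_inject Q_def mult_left_cancel order_less_irrefl)
  have "real (card (Q ` X)) < (real d - 1) - 0"
  proof (rule noncrossing_intervals_card)
    show "finite (Q ` X)" "0 < real d - 1" using X d by auto
  next
    fix p assume "p \<in> Q ` X"
    then obtain w where w: "w \<in> X" "p = Q w" by auto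
    have ne: "cis (fst (P w)) \<noteq> cis (snd (P w))" using P[OF w(1)] cis_inj_2pi[of "fst (P w)" "snd (P w)"] by auto
    have "sin (freq d * (snd (P w) - fst (P w))) = 0"
      using double_pair_angles(1)[OF a _ ne] P[OF w(1)] d by simp
    then obtain n :: int where n: "freq d * (snd (P w) - fst (P w)) = of_int n * pi"
      unfolding sin_zero_iff_int2 by auto
    hence "snd p - fst p = of_int n" by (simp add: w Q_def c_def field_simps)
    moreover have "snd p < real d - 1"
      using P[OF w(1)] c unfolding c2[symmetric] w Q_def by (simp add: mult.commute)
    ultimately show "0 \<le> fst p \<and> fst p < snd p \<and> snd p < real d - 1 \<and> snd p - fst p \<in> \<int>"
      using P[OF w(1)] c by (auto simp: w Q_def)
  next
    fix p q assume pq: "p \<in> Q ` X" "q \<in> Q ` X" "p \<noteq> q"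
    then obtain v w where vw: "v \<in> X" "w \<in> X" "p = Q v" "q = Q w" "v \<noteq> w" by auto
    note Pv = P[OF vw(1)] and Pw = P[OF vw(2)]
    have ne: "fst (P v) \<noteq> fst (P w)" "snd (P v) \<noteq> fst (P w)" "snd (P v) \<noteq> snd (P w)"
      using Pv Pw vw(5) by metis+
    have "snd (P w) < snd (P v) \<or> snd (P v) < fst (P w)" if "fst (P v) < fst (P w)"
    proof (rule ccontr)
      assume "\<not> ?thesis"
      hence "fst (P w) < snd (P v)" "snd (P v) < snd (P w)" using ne by auto
      hence "fpoly d a (cis (fst (P v))) = fpoly d a (cis (fst (P w)))"
        using double_pairs_noncrossing[OF aS that, of "snd (P v)" "snd (P w)"] Pv Pw by auto
      thus False using Pv Pw vw(5) by simp
    qed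
    thus "fst p \<noteq> fst q \<and> (fst p < fst q \<longrightarrow> snd q < snd p \<or> snd p < fst q)"
      using ne c by (auto simp: vw Q_def)
  qed
  thus "card X \<le> d - 2" using card_image[OF inj] by simp
qed

section \<open>Univalence from the boundary\<close>

text \<open>The parameters with a zero form a compact set. At the smallest one the zero is interior,
  while all earlier slices are zero-free, against Hurwitz's theorem; the boundary point 1 shows that
  the slice is not identically zero.\<close>

lemma zero_free_homotopy:
  fixes h :: "real \<times> complex \<Rightarrow> complex"
  assumes cont: "continuous_on ({0..1} \<times> cball 0 1) h"
    and hol: "\<And>s. s \<in> {0..1} \<Longrightarrow> (\<lambda>t. h (s, t)) holomorphic_on ball 0 1"
    and bd: "\<And>s t. s \<in> {0..1} \<Longrightarrow> norm t = 1 \<Longrightarrow> h (s, t) \<noteq> 0"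
    and zero: "\<And>t. norm t < 1 \<Longrightarrow> h (0, t) \<noteq> 0" and t: "norm t < 1"
  shows "h (1, t) \<noteq> 0"
proof
  assume h1: "h (1, t) = 0"
  define Z where "Z = fst ` {p \<in> {0..1} \<times> cball 0 1. h p = 0}"
  have "compact ({0..1::real} \<times> cball (0::complex) 1)" by (intro compact_Times) auto
  moreover from this have "closed {p \<in> {0..1} \<times> cball 0 1. h p = 0}"
    by (intro continuous_closed_preimage_constant cont) (auto intro: compact_imp_closed)
  ultimately have "compact (({0..1} \<times> cball 0 1) \<inter> {p \<in> {0..1} \<times> cball 0 1. h p = 0})"
    by (rule compact_Int_closed)
  moreover have "({0..1} \<times> cball 0 1) \<inter> {p \<in> {0..1} \<times> cball 0 1. h p = 0} = {p \<in> {0..1} \<times> cball 0 1. h p = 0}"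
    by auto
  ultimately have "compact {p \<in> {0..1} \<times> cball 0 1. h p = 0}" by simp
  hence Z: "compact Z" unfolding Z_def by (intro compact_continuous_image continuous_intros)
  have "(1, t) \<in> {p \<in> {0..1} \<times> cball 0 1. h p = 0}" using h1 t by simp
  hence "Z \<noteq> {}" unfolding Z_def by blast
  then obtain s0 where s0: "s0 \<in> Z" "\<And>s. s \<in> Z \<Longrightarrow> s0 \<le> s"
    using compact_attains_inf[OF Z] by auto
  then obtain t0 where t0: "s0 \<in> {0..1}" "norm t0 \<le> 1" "h (s0, t0) = 0" unfolding Z_def by auto
  have t01: "norm t0 < 1" using bd[OF t0(1), of t0] t0 by (cases "norm t0 = 1") auto
  have "s0 \<noteq> 0" using zero[OF t01] t0 by auto
  hence s0p: "s0 > 0" using t0 by simp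
  have "h (s0, t0) \<noteq> 0"
  proof (rule Hurwitz_slice_nonzero[OF cont t0(1) _ _ hol _ _ bd[OF t0(1), of 1] t01])
    show "(\<lambda>n. s0 * (real n / real (Suc n))) \<longlonglongrightarrow> s0"
      using tendsto_mult[OF tendsto_const[of s0] LIMSEQ_n_over_Suc_n] by simp
    fix n
    have lt: "s0 * (real n / real (Suc n)) < s0" "s0 * (real n / real (Suc n)) \<ge> 0"
      using s0p by (auto simp: field_simps)
    thus U: "s0 * (real n / real (Suc n)) \<in> {0..1}" using t0(1) unfolding atLeastAtMost_iff by linarith
    fix t :: complex assume "norm t < 1"
    have "s0 * (real n / real (Suc n)) \<notin> Z" using lt s0(2) by fastforce
    thus "h (s0 * (real n / real (Suc n)), t) \<noteq> 0"
      using U \<open>norm t < 1\<close> unfolding Z_def by force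
  qed auto
  thus False using t0 by simp
qed

text \<open>The disc u = t q, v = t has its boundary on the torus with constant ratio u / v = q. The
  set B absorbs the ratios at which the torus may carry zeros, in particular those of the double
  points of f; the other discs stay zero-free along the homotopy.\<close>

lemma univalent_homotopy:
  fixes a b :: "nat \<Rightarrow> complex" and B :: "complex set"
  assumes a: "a \<in> Sigma_d d" and ok: "coeffs_ok d (\<lambda>k. a k + b k)" and B: "finite B"
    and bd: "\<And>s u v. \<lbrakk>s \<in> {0..1}; norm u = 1; norm v = 1; u \<noteq> v; u / v \<notin> B\<rbrakk>
               \<Longrightarrow> ddiff d (\<lambda>k. a k + of_real s * b k) u v \<noteq> 0"
  shows "(\<lambda>k. a k + b k) \<in> Sigma_d d"
proof -
  define c where "c = (\<lambda>k. a k + b k)"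
  define B' where "B' = insert 1 B"
  have 1: "ddiff d c (t * q) t \<noteq> 0" if q: "norm q = 1" "q \<notin> B'" and t: "norm t < 1" for q t
  proof -
    have "(\<lambda>p. ddiff d (\<lambda>k. a k + of_real (fst p) * b k) (snd p * q) (snd p)) (1, t) \<noteq> 0"
    proof (rule zero_free_homotopy[OF _ _ _ _ t])
      show "continuous_on ({0..1} \<times> cball 0 1) (\<lambda>p. ddiff d (\<lambda>k. a k + of_real (fst p) * b k) (snd p * q) (snd p))"
        by (intro continuous_intros)
      show "(\<lambda>t. ddiff d (\<lambda>k. a k + of_real (fst (s, t)) * b k) (snd (s, t) * q) (snd (s, t))) holomorphic_on ball 0 1" for s
        unfolding fst_conv snd_conv by (intro holomorphic_intros)
      show "ddiff d (\<lambda>k. a k + of_real (fst (s, t)) * b k) (snd (s, t) * q) (snd (s, t)) \<noteq> 0"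
        if "s \<in> {0..1}" "norm t = 1" for s t
      proof -
        have "t \<noteq> 0" using that by auto
        moreover have "t * q \<noteq> t" "t * q / t \<notin> B" using q \<open>t \<noteq> 0\<close> by (auto simp: B'_def)
        ultimately show ?thesis using bd[OF that(1), of "t * q" t] that q by (simp add: norm_mult)
      qed
      show "ddiff d (\<lambda>k. a k + of_real (fst (0, t)) * b k) (snd (0, t) * q) (snd (0, t)) \<noteq> 0" if "norm t < 1" for t
        using ddiff_nonzero_interior[OF a, of "t * q" t] that q by (simp add: norm_mult)
    qed
    thus ?thesis by (simp add: c_def)
  qed
  \<comment> \<open>The excluded ratios, among them q = 1 with its cusps, are limits of admissible
    ones, so Hurwitz's theorem recovers them.\<close>
  have 2: "ddiff d c (t * q) t \<noteq> 0" if q: "norm q = 1" and t: "norm t < 1" for q t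
  proof -
    \<comment> \<open>An injective sequence on the circle with limit q; it eventually leaves the
      finite set \<open>B'\<close>.\<close>
    define x where "x = (\<lambda>n. q * cis (1 / real (Suc n)))"
    have "inj x"
    proof (rule injI)
      fix m n assume "x m = x n"
      hence "cis (1 / real (Suc m)) = cis (1 / real (Suc n))" using q unfolding x_def by auto
      moreover have "\<bar>1 / real (Suc m) - 1 / real (Suc n)\<bar> < 2 * pi"
      proof -
        have "1 / real (Suc k) \<le> 1" "1 / real (Suc k) > 0" for k by auto
        hence "\<bar>1 / real (Suc m) - 1 / real (Suc n)\<bar> \<le> 1" by (smt (verit))
        thus ?thesis using pi_gt3 by linarith
      qed
      ultimately have "1 / real (Suc m) = 1 / real (Suc n)" by (rule cis_inj_2pi)
      thus "m = n" by simp
    qed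
    hence "finite (x -` B')" using B by (intro finite_vimageI) (auto simp: B'_def)
    then obtain N where N: "\<And>n. n \<in> x -` B' \<Longrightarrow> n < N" unfolding finite_nat_set_iff_bounded by auto
    have lim: "x \<longlonglongrightarrow> q"
    proof -
      have "(\<lambda>n. q * cis (1 / real (Suc n))) \<longlonglongrightarrow> q * cis 0"
        unfolding cis_conv_exp by (intro tendsto_intros LIMSEQ_Suc[OF lim_1_over_n])
      thus ?thesis by (simp add: x_def)
    qed
    have "(\<lambda>p. ddiff d c (snd p * fst p) (snd p)) (q, t) \<noteq> 0"
    proof (rule Hurwitz_slice_nonzero[where U = UNIV and x = "\<lambda>n. x (n + N)" and p = 0, OF _ _ _ _ _ _ _ _ t])
      show "continuous_on (UNIV \<times> cball 0 1) (\<lambda>p. ddiff d c (snd p * fst p) (snd p))"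
        by (intro continuous_intros)
      show "(\<lambda>n. x (n + N)) \<longlonglongrightarrow> q" by (rule LIMSEQ_ignore_initial_segment[OF lim])
      show "(\<lambda>t. ddiff d c (snd (y, t) * fst (y, t)) (snd (y, t))) holomorphic_on ball 0 1" for y
        unfolding fst_conv snd_conv by (intro holomorphic_intros)
      show "ddiff d c (snd (x (n + N), t) * fst (x (n + N), t)) (snd (x (n + N), t)) \<noteq> 0" if "norm t < 1" for n t
      proof -
        have "x (n + N) \<notin> B'" using N[of "n + N"] by auto
        moreover have "norm (x (n + N)) = 1" using q by (simp add: x_def norm_mult)
        ultimately show ?thesis using 1 that by simp
      qed
    qed auto
    thus ?thesis by simp
  qed
  \<comment> \<open>For fixed v the disc u = v t has boundary |u| = |v|, settled by the preceding
    step. The homotopy scales v from 0, where the divided difference is 1.\<close>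
  have 3: "ddiff d c (v * t) v \<noteq> 0" if v: "norm v < 1" and t: "norm t \<le> 1" for v t
  proof (cases "norm t = 1")
    case True
    thus ?thesis using 2 v by blast
  next
    case False
    hence t1: "norm t < 1" using t by simp
    have "(\<lambda>p. ddiff d c (of_real (fst p) * v * snd p) (of_real (fst p) * v)) (1, t) \<noteq> 0"
    proof (rule zero_free_homotopy[OF _ _ _ _ t1])
      show "continuous_on ({0..1} \<times> cball 0 1) (\<lambda>p. ddiff d c (of_real (fst p) * v * snd p) (of_real (fst p) * v))"
        by (intro continuous_intros)
      show "(\<lambda>t. ddiff d c (of_real (fst (s, t)) * v * snd (s, t)) (of_real (fst (s, t)) * v)) holomorphic_on ball 0 1" for s
        unfolding fst_conv snd_conv by (intro holomorphic_intros)
      show "ddiff d c (of_real (fst (s, t)) * v * snd (s, t)) (of_real (fst (s, t)) * v) \<noteq> 0"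
        if s: "s \<in> {0..1}" "norm t = 1" for s t
      proof -
        have "norm (of_real s * v) \<le> 1 * norm v"
          unfolding norm_mult using s by (intro mult_right_mono) auto
        thus ?thesis using 2[OF s(2), of "of_real s * v"] v by simp
      qed
    qed auto
    thus ?thesis by simp
  qed
  have 4: "ddiff d c u v \<noteq> 0" if "norm u \<le> norm v" "norm v < 1" "v \<noteq> 0" for u v
    using 3[OF that(2), of "u / v"] that by (simp add: norm_divide)
  have "inj_on (fpoly d c) {z. 1 < norm z}"
  proof (rule inj_onI, rule ccontr)
    fix z w assume zw: "z \<in> {z. 1 < norm z}" "w \<in> {z. 1 < norm z}" "fpoly d c z = fpoly d c w" "z \<noteq> w"
    define u where "u = inverse z"
    define v where "v = inverse w"
    have uv: "u \<noteq> 0" "v \<noteq> 0" "u \<noteq> v" "norm u < 1" "norm v < 1"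
      using zw by (auto simp: u_def v_def norm_inverse inverse_less_1_iff)
    have "ddiff d c u v = 0" using uv zw(3) by (subst ddiff_eq_0_iff) (auto simp: u_def v_def)
    thus False using 4[of u v] 4[of v u] uv ddiff_commute[of d c u v] by (cases "norm u \<le> norm v") auto
  qed
  thus ?thesis using ok by (simp add: Sigma_d_def c_def)
qed

section \<open>The boundary curve and its perturbations\<close>

text \<open>The t-derivative of \<open>tanfac\<close>, written as a finite trigonometric sum so that
  joint continuity in coefficients and angle is immediate.\<close>

definition tanfac' :: "nat \<Rightarrow> (nat \<Rightarrow> complex) \<Rightarrow> real \<Rightarrow> complex" where
  "tanfac' d a t = \<i> * of_real (freq d + 1) * cis ((freq d + 1) * t)
     - (\<Sum>k=1..d. of_nat k * a k * (\<i> * of_real (freq d - real k) * cis ((freq d - real k) * t)))"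

lemma cis_mult_has_vector_derivative:
  "((\<lambda>t. cis (c * t)) has_vector_derivative \<i> * of_real c * cis (c * t)) (at t)"
  unfolding cis_conv_exp
  by (auto intro!: derivative_eq_intros has_vector_derivative_real_field simp: mult_ac)

lemma tanfac_eq:
  "tanfac d a t = cis ((freq d + 1) * t) - (\<Sum>k=1..d. of_nat k * a k * cis ((freq d - real k) * t))"
proof -
  have "cis ((freq d + 1) * t) / cis t ^ Suc k = cis ((freq d - real k) * t)" for k
    unfolding Complex.DeMoivre cis_divide by (simp add: algebra_simps)
  hence "cis ((freq d + 1) * t) * (of_nat k * a k / cis t ^ Suc k) = of_nat k * a k * cis ((freq d - real k) * t)" for k
    by (metis (no_types, lifting) mult.commute times_divide_eq_right)
  thus ?thesis
    by (simp add: tanfac_def fprime_def right_diff_distrib sum_distrib_left del: power_Suc)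
qed

lemma tanfac_has_vector_derivative:
  "(tanfac d a has_vector_derivative tanfac' d a t) (at t)"
proof -
  have "((\<lambda>t. cis ((freq d + 1) * t) - (\<Sum>k=1..d. of_nat k * a k * cis ((freq d - real k) * t)))
          has_vector_derivative tanfac' d a t) (at t)"
    unfolding tanfac'_def
    by (intro has_vector_derivative_diff has_vector_derivative_sum cis_mult_has_vector_derivative
        has_vector_derivative_mult_right)
  thus ?thesis by (simp add: tanfac_eq[abs_def])
qed

lemma Re_tanfac_DERIV: "((\<lambda>t. Re (tanfac d a t)) has_real_derivative Re (tanfac' d a t)) (at t)"
  unfolding has_real_derivative_iff_has_vector_derivative
  by (rule bounded_linear.has_vector_derivative[OF bounded_linear_Re tanfac_has_vector_derivative])

lemma continuous_on_cis [continuous_intros]: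
  "continuous_on S f \<Longrightarrow> continuous_on S (\<lambda>x. cis (f x))"
  unfolding cis_conv_exp by (intro continuous_intros)

lemma continuous_on_tanfac [continuous_intros]:
  assumes "\<And>k. continuous_on S (\<lambda>x. a x k)" "continuous_on S t"
  shows "continuous_on S (\<lambda>x. tanfac d (a x) (t x))" "continuous_on S (\<lambda>x. tanfac' d (a x) (t x))"
  unfolding tanfac_eq tanfac'_def by (intro continuous_intros assms)+

lemma continuous_on_fpoly_cis [continuous_intros]:
  assumes "\<And>k. continuous_on S (\<lambda>x. a x k)" "continuous_on S t"
  shows "continuous_on S (\<lambda>x. fpoly d (a x) (cis (t x)))"
  unfolding fpoly_def by (intro continuous_intros assms) auto

lemma fpoly_cis_has_vector_derivative:
  assumes "Im (tanfac d a t) = 0"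
  shows "((\<lambda>t. fpoly d a (cis t)) has_vector_derivative
           \<i> * cis (- freq d * t) * of_real (Re (tanfac d a t))) (at t)"
proof -
  have "(cis has_vector_derivative \<i> * cis t) (at t)"
    using cis_mult_has_vector_derivative[of 1 t] by simp
  from field_vector_diff_chain_at[OF this fpoly_has_field_derivative[of "cis t" d a]]
  have "((\<lambda>t. fpoly d a (cis t)) has_vector_derivative \<i> * cis t * fprime d a (cis t)) (at t)"
    by (simp add: o_def)
  moreover have "of_real (Re (tanfac d a t)) = tanfac d a t" using assms by (simp add: complex_eq_iff)
  moreover have "cis (- freq d * t) * tanfac d a t = cis t * fprime d a (cis t)"
    unfolding tanfac_def mult.assoc[symmetric] cis_mult by (simp add: algebra_simps)
  ultimately show ?thesis by (simp add: mult.assoc)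
qed

text \<open>Rotation by cis (freq d * c) makes the tangent direction at c vertical: the real part
  measures displacement along the normal at c, the imaginary part along the tangent.\<close>

lemma component_DERIV:
  assumes "Im (tanfac d a t) = 0"
  shows "((\<lambda>t. Re (cis (freq d * c) * fpoly d a (cis t))) has_real_derivative
           sin (freq d * (t - c)) * Re (tanfac d a t)) (at t)"
    and "((\<lambda>t. Im (cis (freq d * c) * fpoly d a (cis t))) has_real_derivative
           cos (freq d * (t - c)) * Re (tanfac d a t)) (at t)"
proof -
  define r where "r = Re (tanfac d a t)"
  have v: "((\<lambda>t. cis (freq d * c) * fpoly d a (cis t)) has_vector_derivative
         cis (freq d * c) * (\<i> * cis (- freq d * t) * of_real r)) (at t)"
    unfolding r_def by (intro has_vector_derivative_mult_right fpoly_cis_has_vector_derivative assms)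
  have "cis (freq d * c) * (\<i> * cis (- freq d * t) * of_real r) = \<i> * (cis (freq d * c) * cis (- freq d * t)) * of_real r"
    by simp
  also have "\<dots> = \<i> * cis (- (freq d * (t - c))) * of_real r"
    unfolding cis_mult by (simp add: algebra_simps)
  finally have e: "cis (freq d * c) * (\<i> * cis (- freq d * t) * of_real r) = \<i> * cis (- (freq d * (t - c))) * of_real r" .
  show "((\<lambda>t. Re (cis (freq d * c) * fpoly d a (cis t))) has_real_derivative
           sin (freq d * (t - c)) * Re (tanfac d a t)) (at t)"
    using bounded_linear.has_vector_derivative[OF bounded_linear_Re v[unfolded e]]
    unfolding has_real_derivative_iff_has_vector_derivative r_def by simp
  show "((\<lambda>t. Im (cis (freq d * c) * fpoly d a (cis t))) has_real_derivative
           cos (freq d * (t - c)) * Re (tanfac d a t)) (at t)"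
    using bounded_linear.has_vector_derivative[OF bounded_linear_Im v[unfolded e]]
    unfolding has_real_derivative_iff_has_vector_derivative r_def by simp
qed

lemma sin_same_sign:
  assumes "0 < w" "z \<noteq> 0" "\<bar>w * z\<bar> < pi"
  shows "z * sin (w * z) > 0"
proof (cases "z > 0")
  case True
  hence "sin (w * z) > 0" using assms by (intro sin_gt_zero) auto
  thus ?thesis using True by simp
next
  case False
  hence z: "z < 0" using assms by simp
  hence "sin (w * (- z)) > 0" using assms by (intro sin_gt_zero) (auto simp: mult_pos_neg)
  hence "sin (w * z) < 0" by simp
  thus ?thesis using z by (simp add: mult_neg_neg)
qed

text \<open>Concavity: near \<open>c\<close> the curve stays on one side of its tangent line, whose normal at \<open>c\<close> is also the
  normal at \<open>\<alpha>\<close> as the sine vanishes.\<close>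

lemma arc_strictly_one_sided:
  assumes d: "d \<ge> 2" and real: "\<And>t. Im (tanfac d a t) = 0"
    and sin0: "sin (freq d * (c - \<alpha>)) = 0" and t: "t \<noteq> c" "\<bar>freq d * (t - c)\<bar> < pi"
    and pos: "\<And>s. s \<in> closed_segment c t \<Longrightarrow> s \<noteq> c \<Longrightarrow> \<rho> * Re (tanfac d a s) > 0"
  shows "\<rho> * cos (freq d * (c - \<alpha>)) * (Re (cis (freq d * \<alpha>) * fpoly d a (cis t))
           - Re (cis (freq d * \<alpha>) * fpoly d a (cis c))) > 0"
proof -
  define w where "w = freq d"
  have w: "w > 0" using d by (simp add: w_def freq_def)
  define \<psi> where "\<psi> = (\<lambda>t. Re (cis (w * \<alpha>) * fpoly d a (cis t)))"
  define C where "C = cos (w * (c - \<alpha>))"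
  have C: "C \<noteq> 0" using sin0 sin_zero_abs_cos_one[of "w * (c - \<alpha>)"] by (auto simp: C_def w_def)
  have D: "(\<psi> has_real_derivative sin (w * (s - \<alpha>)) * Re (tanfac d a s)) (at s)" for s
    unfolding \<psi>_def w_def by (rule component_DERIV(1)[OF real])
  have "\<exists>s. s \<in> closed_segment c t \<and> s \<noteq> c \<and> (s - c) * (t - c) > 0 \<and> \<bar>s - c\<bar> \<le> \<bar>t - c\<bar> \<and>
          \<psi> t - \<psi> c = (t - c) * (sin (w * (s - \<alpha>)) * Re (tanfac d a s))"
  proof (cases "c < t")
    case True
    then obtain s where "c < s" "s < t" "\<psi> t - \<psi> c = (t - c) * (sin (w * (s - \<alpha>)) * Re (tanfac d a s))"
      using MVT2[OF True D] by auto
    thus ?thesis using True by (intro exI[of _ s]) (auto simp: closed_segment_eq_real_ivl)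
  next
    case False
    hence lt: "t < c" using t by simp
    then obtain s where "t < s" "s < c" "\<psi> c - \<psi> t = (c - t) * (sin (w * (s - \<alpha>)) * Re (tanfac d a s))"
      using MVT2[OF lt D] by auto
    moreover from this have "(s - c) * (t - c) > 0" using lt by (intro mult_neg_neg) auto
    moreover from calculation have "\<psi> t - \<psi> c = (t - c) * (sin (w * (s - \<alpha>)) * Re (tanfac d a s))"
      by (simp add: left_diff_distrib)
    ultimately show ?thesis using lt
      by (intro exI[of _ s]) (auto simp: closed_segment_eq_real_ivl)
  qed
  then obtain s where s: "s \<in> closed_segment c t" "s \<noteq> c" "(s - c) * (t - c) > 0" "\<bar>s - c\<bar> \<le> \<bar>t - c\<bar>"
    and eq: "\<psi> t - \<psi> c = (t - c) * (sin (w * (s - \<alpha>)) * Re (tanfac d a s))" by auto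
  \<comment> \<open>Because sin (w * (c - \<alpha>)) = 0, the addition theorem replaces \<alpha> by
    c at the cost of the sign C.\<close>
  have "w * (s - \<alpha>) = w * (s - c) + w * (c - \<alpha>)" by (simp add: algebra_simps)
  hence sn: "sin (w * (s - \<alpha>)) = sin (w * (s - c)) * C"
    using sin0 by (simp add: sin_add C_def w_def)
  have "\<bar>w * (s - c)\<bar> \<le> \<bar>w * (t - c)\<bar>" using s(4) w by (simp add: abs_mult)
  hence "(s - c) * sin (w * (s - c)) > 0"
    using w s t by (intro sin_same_sign) (auto simp: w_def)
  hence "(t - c) * sin (w * (s - c)) > 0" using s(3) by (auto simp: zero_less_mult_iff)
  moreover have "\<rho> * Re (tanfac d a s) > 0" using pos s by auto
  moreover have "C\<^sup>2 > 0" using C by simp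
  ultimately have "C\<^sup>2 * ((t - c) * sin (w * (s - c))) * (\<rho> * Re (tanfac d a s)) > 0"
    by simp
  also have "C\<^sup>2 * ((t - c) * sin (w * (s - c))) * (\<rho> * Re (tanfac d a s)) = \<rho> * C * (\<psi> t - \<psi> c)"
    unfolding eq sn by (simp add: power2_eq_square)
  finally show ?thesis by (simp add: \<psi>_def C_def w_def)
qed

text \<open>Equal endpoints force a zero of the tangential factor in between, by Rolle's theorem for
  a tangential component. If the factor is strictly monotone, this zero is a cusp with a sign
  change, and the two halves of the arc lie strictly on opposite sides of the tangent line
  there.\<close>

lemma arc_locally_injective:
  assumes d: "d \<ge> 2" and real: "\<And>t. Im (tanfac d a t) = 0"
    and xy: "x < y" "freq d * (y - x) < pi"
    and reg: "(\<forall>s\<in>{x..y}. Re (tanfac d a s) \<noteq> 0) \<or> (\<forall>s\<in>{x..y}. \<rho> * Re (tanfac' d a s) > 0)"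
  shows "fpoly d a (cis x) \<noteq> fpoly d a (cis y)"
proof
  assume eq: "fpoly d a (cis x) = fpoly d a (cis y)"
  define w where "w = freq d"
  have w: "w > 0" using d by (simp add: w_def freq_def)
  \<comment> \<open>From the midpoint all angles w * (c - m) stay below pi / 2, so the cosine is
    positive.\<close>
  define m where "m = (x + y) / 2"
  have "\<exists>c. x < c \<and> c < y \<and> Re (tanfac d a c) = 0"
  proof -
    obtain c where c: "x < c" "c < y"
      "Im (cis (w * m) * fpoly d a (cis y)) - Im (cis (w * m) * fpoly d a (cis x))
         = (y - x) * (cos (w * (c - m)) * Re (tanfac d a c))"
      using MVT2[OF xy(1) component_DERIV(2)[OF real]] unfolding w_def by blast
    have "\<bar>c - m\<bar> < (y - x) / 2" using c by (auto simp: m_def abs_if field_simps)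
    hence "w * \<bar>c - m\<bar> < w * ((y - x) / 2)" using w by simp
    moreover have "w * ((y - x) / 2) = w * (y - x) / 2" "\<bar>w * (c - m)\<bar> = w * \<bar>c - m\<bar>"
      using w by (simp_all add: abs_mult)
    ultimately have "\<bar>w * (c - m)\<bar> < pi / 2" using xy(2) unfolding w_def[symmetric] by linarith
    hence "cos (w * (c - m)) > 0" by (intro cos_gt_zero_pi) auto
    hence "Re (tanfac d a c) = 0" using c(3) xy eq by simp
    thus ?thesis using c by blast
  qed
  then obtain c where c: "x < c" "c < y" "Re (tanfac d a c) = 0" by blast
  have reg': "\<rho> * Re (tanfac' d a s) > 0" if "s \<in> {x..y}" for s
    using reg c that by force
  have sgn: "(s - c) * (\<rho> * Re (tanfac d a s)) > 0" if s: "s \<in> {x..y}" "s \<noteq> c" for s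
  proof -
    have "\<exists>z. z \<in> {x..y} \<and> Re (tanfac d a s) = (s - c) * Re (tanfac' d a z)"
    proof (cases "c < s")
      case True
      from MVT2[OF this Re_tanfac_DERIV[of d a]] obtain z where "c < z" "z < s"
         "Re (tanfac d a s) - Re (tanfac d a c) = (s - c) * Re (tanfac' d a z)" by blast
      thus ?thesis using c s by (intro exI[of _ z]) auto
    next
      case False
      hence "s < c" using s by simp
      from MVT2[OF this Re_tanfac_DERIV[of d a]] obtain z where "s < z" "z < c"
         "Re (tanfac d a c) - Re (tanfac d a s) = (c - s) * Re (tanfac' d a z)" by blast
      thus ?thesis using c s by (intro exI[of _ z]) (auto simp: algebra_simps)
    qed
    then obtain z where z: "z \<in> {x..y}" "Re (tanfac d a s) = (s - c) * Re (tanfac' d a z)" by blast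
    have "(s - c)\<^sup>2 * (\<rho> * Re (tanfac' d a z)) > 0" using reg'[OF z(1)] s by simp
    thus ?thesis unfolding z(2) by (simp add: power2_eq_square mult_ac)
  qed
  have bnd: "w * (y - c) < pi" "w * (c - x) < pi"
  proof -
    have "w * (y - c) \<le> w * (y - x)" "w * (c - x) \<le> w * (y - x)" using w c by auto
    thus "w * (y - c) < pi" "w * (c - x) < pi" using xy by (auto simp: w_def)
  qed
  have 1: "\<rho> * cos (freq d * (c - c)) * (Re (cis (freq d * c) * fpoly d a (cis y))
           - Re (cis (freq d * c) * fpoly d a (cis c))) > 0"
  proof (rule arc_strictly_one_sided[OF d real])
    fix s assume s: "s \<in> closed_segment c y" "s \<noteq> c"
    hence "s \<in> {x..y}" "s - c > 0" using c by (auto simp: closed_segment_eq_real_ivl)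
    thus "\<rho> * Re (tanfac d a s) > 0" using sgn[of s] s(2) zero_less_mult_pos by blast
  qed (use c bnd w in \<open>auto simp: w_def\<close>)
  have 2: "(- \<rho>) * cos (freq d * (c - c)) * (Re (cis (freq d * c) * fpoly d a (cis x))
           - Re (cis (freq d * c) * fpoly d a (cis c))) > 0"
  proof (rule arc_strictly_one_sided[OF d real])
    fix s assume s: "s \<in> closed_segment c x" "s \<noteq> c"
    hence "s \<in> {x..y}" "s - c < 0" using c by (auto simp: closed_segment_eq_real_ivl split: if_splits)
    thus "- \<rho> * Re (tanfac d a s) > 0" using sgn[of s] s(2) by (auto simp: zero_less_mult_iff mult_less_0_iff)
  qed (use c bnd w in \<open>auto simp: w_def abs_mult\<close>)
  show False using 1 2 unfolding eq by simp
qed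

text \<open>A simple zero of f' is a simple zero of the tangential factor, whose derivative is real
  along with it.\<close>

lemma tanfac'_nonzero_at_cusp:
  assumes a: "a \<in> Sigma_star d" and d: "d \<ge> 1" and z: "Re (tanfac d a t) = 0"
  shows "Re (tanfac' d a t) \<noteq> 0"
proof -
  have aS: "a \<in> Sigma_d d" using a by (simp add: Sigma_star_def)
  have "tanfac d a t = 0" using z tanfac_real[OF a d] by (simp add: complex_eq_iff)
  hence f0: "fprime d a (cis t) = 0" by (simp add: tanfac_def)
  obtain c where c: "c \<noteq> 0" "(fprime d a has_field_derivative c) (at (cis t))"
    using simple_critical_point[OF aS _ f0] by auto
  have "(cis has_vector_derivative \<i> * cis t) (at t)"
    using cis_mult_has_vector_derivative[of 1 t] by simp
  from field_vector_diff_chain_at[OF this c(2)]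
  have f': "((\<lambda>t. fprime d a (cis t)) has_vector_derivative \<i> * cis t * c) (at t)" by (simp add: o_def)
  have "((\<lambda>t. cis ((freq d + 1) * t) * fprime d a (cis t)) has_vector_derivative
     cis ((freq d + 1) * t) * (\<i> * cis t * c) + \<i> * of_real (freq d + 1) * cis ((freq d + 1) * t) * fprime d a (cis t)) (at t)"
    by (intro has_vector_derivative_mult cis_mult_has_vector_derivative f')
  hence "(tanfac d a has_vector_derivative cis ((freq d + 1) * t) * (\<i> * cis t * c)) (at t)"
    by (simp add: f0 tanfac_def[abs_def])
  hence "tanfac' d a t = cis ((freq d + 1) * t) * (\<i> * cis t * c)"
    using tanfac_has_vector_derivative vector_derivative_unique_at by blast
  hence "tanfac' d a t \<noteq> 0" using c by simp
  moreover have "Im (tanfac' d a t) = 0"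
  proof -
    have "((\<lambda>t. Im (tanfac d a t)) has_real_derivative Im (tanfac' d a t)) (at t)"
      unfolding has_real_derivative_iff_has_vector_derivative
      by (rule bounded_linear.has_vector_derivative[OF bounded_linear_Im tanfac_has_vector_derivative])
    moreover have "(\<lambda>t. Im (tanfac d a t)) = (\<lambda>_. 0)" using tanfac_real[OF a d] by auto
    ultimately show ?thesis using DERIV_unique[OF _ DERIV_const] by metis
  qed
  ultimately show ?thesis by (simp add: complex_eq_iff)
qed

lemma positive_near:
  fixes g :: "real \<times> real \<Rightarrow> real"
  assumes "continuous_on UNIV g" "g (0, t) > 0"
  shows "\<exists>\<delta>>0. \<forall>\<epsilon> s. \<bar>\<epsilon>\<bar> < \<delta> \<longrightarrow> \<bar>s - t\<bar> < \<delta> \<longrightarrow> g (\<epsilon>, s) > 0"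
proof -
  have "open {p. 0 < g p}" by (intro open_Collect_less continuous_intros assms)
  then obtain A B where AB: "open A" "open B" "(0, t) \<in> A \<times> B" "A \<times> B \<subseteq> {p. 0 < g p}"
    using assms(2) by (metis mem_Collect_eq open_prod_elim)
  obtain r1 where r1: "r1 > 0" "ball 0 r1 \<subseteq> A" using AB by (auto elim: openE)
  obtain r2 where r2: "r2 > 0" "ball t r2 \<subseteq> B" using AB by (auto elim: openE)
  show ?thesis
  proof (intro exI[of _ "min r1 r2"] conjI allI impI)
    fix \<epsilon> s assume "\<bar>\<epsilon>\<bar> < min r1 r2" "\<bar>s - t\<bar> < min r1 r2"
    hence "\<epsilon> \<in> ball 0 r1" "s \<in> ball t r2" by (auto simp: dist_real_def)
    thus "g (\<epsilon>, s) > 0" using r1 r2 AB by blast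
  qed (use r1 r2 in auto)
qed

section \<open>Stability of the boundary curve under deformations that keep the tangential factor
  real\<close>

context
  fixes d :: nat and a b :: "nat \<Rightarrow> complex"
  assumes a: "a \<in> Sigma_star d" and d: "d \<ge> 2"
    and real: "\<And>\<epsilon> t. Im (tanfac d (\<lambda>k. a k + of_real \<epsilon> * b k) t) = 0"
begin

abbreviation (input) pert :: "real \<Rightarrow> nat \<Rightarrow> complex" where
  "pert \<epsilon> \<equiv> (\<lambda>k. a k + of_real \<epsilon> * b k)"

text \<open>Away from cusps the tangential factor stays nonzero near t; at a cusp its derivative
  keeps its sign. Both persist for small \<epsilon> by joint continuity.\<close>

lemma perturbed_arc_injective:
  "\<exists>\<delta>>0. \<forall>\<epsilon> x y. \<bar>\<epsilon>\<bar> < \<delta> \<longrightarrow> \<bar>x - t\<bar> < \<delta> \<longrightarrow> \<bar>y - t\<bar> < \<delta> \<longrightarrow> x < y \<longrightarrow>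
     fpoly d (pert \<epsilon>) (cis x) \<noteq> fpoly d (pert \<epsilon>) (cis y)"
proof -
  define w where "w = freq d"
  have w: "w > 0" using d by (simp add: w_def freq_def)
  define \<rho> where "\<rho> = Re (tanfac' d a t)"
  obtain \<delta> where \<delta>: "\<delta> > 0"
    "(\<forall>\<epsilon> s. \<bar>\<epsilon>\<bar> < \<delta> \<longrightarrow> \<bar>s - t\<bar> < \<delta> \<longrightarrow> Re (tanfac d (pert \<epsilon>) s) \<noteq> 0) \<or>
     (\<forall>\<epsilon> s. \<bar>\<epsilon>\<bar> < \<delta> \<longrightarrow> \<bar>s - t\<bar> < \<delta> \<longrightarrow> \<rho> * Re (tanfac' d (pert \<epsilon>) s) > 0)"
  proof (cases "Re (tanfac d a t) = 0")
    case True
    hence "\<rho> \<noteq> 0" unfolding \<rho>_def using tanfac'_nonzero_at_cusp[OF a] d by simp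
    have "\<exists>\<delta>>0. \<forall>\<epsilon> s. \<bar>\<epsilon>\<bar> < \<delta> \<longrightarrow> \<bar>s - t\<bar> < \<delta> \<longrightarrow>
            (\<lambda>p. \<rho> * Re (tanfac' d (pert (fst p)) (snd p))) (\<epsilon>, s) > 0"
    proof (rule positive_near)
      show "continuous_on UNIV (\<lambda>p. \<rho> * Re (tanfac' d (pert (fst p)) (snd p)))" by (intro continuous_intros)
      show "\<rho> * Re (tanfac' d (pert (fst (0, t))) (snd (0, t))) > 0" using \<open>\<rho> \<noteq> 0\<close> by (simp add: \<rho>_def flip: power2_eq_square)
    qed
    thus ?thesis using that by auto
  next
    case False
    have "\<exists>\<delta>>0. \<forall>\<epsilon> s. \<bar>\<epsilon>\<bar> < \<delta> \<longrightarrow> \<bar>s - t\<bar> < \<delta> \<longrightarrow>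
            (\<lambda>p. \<bar>Re (tanfac d (pert (fst p)) (snd p))\<bar>) (\<epsilon>, s) > 0"
    proof (rule positive_near)
      show "continuous_on UNIV (\<lambda>p. \<bar>Re (tanfac d (pert (fst p)) (snd p))\<bar>)" by (intro continuous_intros)
      show "\<bar>Re (tanfac d (pert (fst (0, t))) (snd (0, t)))\<bar> > 0" using False by simp
    qed
    thus ?thesis using that by auto
  qed
  show ?thesis
  proof (intro exI[of _ "min \<delta> (pi / (2 * w))"] conjI allI impI)
    fix \<epsilon> x y
    assume *: "\<bar>\<epsilon>\<bar> < min \<delta> (pi / (2 * w))" "\<bar>x - t\<bar> < min \<delta> (pi / (2 * w))" "\<bar>y - t\<bar> < min \<delta> (pi / (2 * w))" "x < y"
    have "y - x < 2 * (pi / (2 * w))" using * by linarith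
    hence "freq d * (y - x) < pi" using w by (simp add: field_simps w_def)
    moreover have "\<bar>s - t\<bar> < \<delta>" if "s \<in> {x..y}" for s using that * by auto
    ultimately show "fpoly d (pert \<epsilon>) (cis x) \<noteq> fpoly d (pert \<epsilon>) (cis y)"
      using \<delta>(2) * by (intro arc_locally_injective[OF d real, where \<rho> = \<rho>]) auto
  qed (use \<delta> w in auto)
qed

text \<open>After the perturbation both branches still touch the same tangent line, from opposite sides and at the
  old parameters only.\<close>

lemma perturbed_double_pair_rigid:
  assumes ne: "cis \<alpha> \<noteq> cis \<beta>" and eq: "fpoly d a (cis \<alpha>) = fpoly d a (cis \<beta>)"
    and normal: "Re (cis (freq d * \<alpha>) * ((\<Sum>k=1..d. b k / cis \<alpha> ^ k) - (\<Sum>k=1..d. b k / cis \<beta> ^ k))) = 0"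
  shows "\<exists>\<delta>>0. \<forall>\<epsilon> x y. \<bar>\<epsilon>\<bar> < \<delta> \<longrightarrow> \<bar>x - \<alpha>\<bar> < \<delta> \<longrightarrow> \<bar>y - \<beta>\<bar> < \<delta> \<longrightarrow>
     fpoly d (pert \<epsilon>) (cis x) = fpoly d (pert \<epsilon>) (cis y) \<longrightarrow> x = \<alpha> \<and> y = \<beta>"
proof -
  define w where "w = freq d"
  have w: "w > 0" using d by (simp add: w_def freq_def)
  define C where "C = cos (freq d * (\<beta> - \<alpha>))"
  define r1 where "r1 = Re (tanfac d a \<alpha>)"
  define r2 where "r2 = Re (tanfac d a \<beta>)"
  have s0: "sin (freq d * (\<beta> - \<alpha>)) = 0" and neg: "C * r1 * r2 < 0"
    using double_pair_angles[OF a _ ne eq] d by (auto simp: C_def r1_def r2_def)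
  have near: "\<exists>\<delta>>0. \<forall>\<epsilon> s. \<bar>\<epsilon>\<bar> < \<delta> \<longrightarrow> \<bar>s - t\<bar> < \<delta> \<longrightarrow> Re (tanfac d a t) * Re (tanfac d (pert \<epsilon>) s) > 0"
    if "Re (tanfac d a t) \<noteq> 0" for t
  proof -
    have "\<exists>\<delta>>0. \<forall>\<epsilon> s. \<bar>\<epsilon>\<bar> < \<delta> \<longrightarrow> \<bar>s - t\<bar> < \<delta> \<longrightarrow>
            (\<lambda>p. Re (tanfac d a t) * Re (tanfac d (pert (fst p)) (snd p))) (\<epsilon>, s) > 0"
    proof (rule positive_near)
      show "continuous_on UNIV (\<lambda>p. Re (tanfac d a t) * Re (tanfac d (pert (fst p)) (snd p)))"
        by (intro continuous_intros)
      show "Re (tanfac d a t) * Re (tanfac d (pert (fst (0, t))) (snd (0, t))) > 0" using that by (simp flip: power2_eq_square)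
    qed
    thus ?thesis by simp
  qed
  have rne: "Re (tanfac d a \<alpha>) \<noteq> 0" "Re (tanfac d a \<beta>) \<noteq> 0"
    using neg by (auto simp: r1_def r2_def)
  obtain \<delta>1 where \<delta>1: "\<delta>1 > 0" "\<And>\<epsilon> s. \<bar>\<epsilon>\<bar> < \<delta>1 \<Longrightarrow> \<bar>s - \<alpha>\<bar> < \<delta>1 \<Longrightarrow> r1 * Re (tanfac d (pert \<epsilon>) s) > 0"
    using near[OF rne(1)] unfolding r1_def by metis
  obtain \<delta>2 where \<delta>2: "\<delta>2 > 0" "\<And>\<epsilon> s. \<bar>\<epsilon>\<bar> < \<delta>2 \<Longrightarrow> \<bar>s - \<beta>\<bar> < \<delta>2 \<Longrightarrow> r2 * Re (tanfac d (pert \<epsilon>) s) > 0"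
    using near[OF rne(2)] unfolding r2_def by metis
  define \<delta> where "\<delta> = min (min \<delta>1 \<delta>2) (pi / w)"
  show ?thesis
  proof (intro exI[of _ \<delta>] conjI allI impI)
    show "\<delta> > 0" using \<delta>1 \<delta>2 w by (simp add: \<delta>_def)
    fix \<epsilon> x y
    assume *: "\<bar>\<epsilon>\<bar> < \<delta>" "\<bar>x - \<alpha>\<bar> < \<delta>" "\<bar>y - \<beta>\<bar> < \<delta>"
      and e: "fpoly d (pert \<epsilon>) (cis x) = fpoly d (pert \<epsilon>) (cis y)"
    define \<psi> where "\<psi> = (\<lambda>t. Re (cis (freq d * \<alpha>) * fpoly d (pert \<epsilon>) (cis t)))"
    have small: "\<bar>freq d * z\<bar> < pi" if "\<bar>z\<bar> < \<delta>" for z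
    proof -
      have "\<bar>z\<bar> < pi / w" using that by (simp add: \<delta>_def)
      thus ?thesis using w by (simp add: abs_mult w_def field_simps)
    qed
    have A: "r1 * (\<psi> x - \<psi> \<alpha>) > 0" if "x \<noteq> \<alpha>"
    proof -
      have "r1 * cos (freq d * (\<alpha> - \<alpha>)) * (\<psi> x - \<psi> \<alpha>) > 0"
        unfolding \<psi>_def
      proof (rule arc_strictly_one_sided[OF d real _ that small[OF *(2)]])
        fix s assume "s \<in> closed_segment \<alpha> x"
        hence "\<bar>s - \<alpha>\<bar> < \<delta>" using * by (auto simp: closed_segment_eq_real_ivl split: if_splits)
        thus "r1 * Re (tanfac d (pert \<epsilon>) s) > 0" using * by (intro \<delta>1(2)) (auto simp: \<delta>_def)
      qed simp
      thus ?thesis by simp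
    qed
    have B: "r2 * C * (\<psi> y - \<psi> \<beta>) > 0" if "y \<noteq> \<beta>"
      unfolding \<psi>_def C_def
    proof (rule arc_strictly_one_sided[OF d real s0 that small[OF *(3)]])
      fix s assume "s \<in> closed_segment \<beta> y"
      hence "\<bar>s - \<beta>\<bar> < \<delta>" using * by (auto simp: closed_segment_eq_real_ivl split: if_splits)
      thus "r2 * Re (tanfac d (pert \<epsilon>) s) > 0" using * by (intro \<delta>2(2)) (auto simp: \<delta>_def)
    qed
    have split: "fpoly d (pert \<epsilon>) z = fpoly d a z + of_real \<epsilon> * (\<Sum>k=1..d. b k / z ^ k)" for z
      by (simp add: fpoly_def add_divide_distrib sum.distrib sum_distrib_left)
    have "cis (freq d * \<alpha>) * fpoly d (pert \<epsilon>) (cis \<alpha>) - cis (freq d * \<alpha>) * fpoly d (pert \<epsilon>) (cis \<beta>)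
        = of_real \<epsilon> * (cis (freq d * \<alpha>) * ((\<Sum>k=1..d. b k / cis \<alpha> ^ k) - (\<Sum>k=1..d. b k / cis \<beta> ^ k)))"
      unfolding split eq by (simp add: algebra_simps)
    hence "\<psi> \<alpha> - \<psi> \<beta> = Re (of_real \<epsilon> * (cis (freq d * \<alpha>) * ((\<Sum>k=1..d. b k / cis \<alpha> ^ k) - (\<Sum>k=1..d. b k / cis \<beta> ^ k))))"
      unfolding \<psi>_def by (metis minus_complex.sel(1))
    hence "\<psi> \<alpha> = \<psi> \<beta>" using normal by simp
    hence D: "\<psi> y - \<psi> \<beta> = \<psi> x - \<psi> \<alpha>" using e by (simp add: \<psi>_def)
    \<comment> \<open>The common normal displacement of the two branches. It has the sign of r1
      unless x = \<alpha> and that of r2 C unless y = \<beta>, and these signs are opposite.\<close>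
    define D where "D = \<psi> x - \<psi> \<alpha>"
    have "r1 * D \<ge> 0" using A by (cases "x = \<alpha>") (auto simp: D_def)
    moreover have "r2 * C * D \<ge> 0" using B by (cases "y = \<beta>") (auto simp: D_def D[symmetric])
    ultimately have "(r1 * D) * (r2 * C * D) \<ge> 0" by (rule mult_nonneg_nonneg)
    hence "(C * r1 * r2) * D\<^sup>2 \<ge> 0" by (simp add: power2_eq_square mult_ac)
    hence "D = 0" using mult_neg_pos[OF neg, of "D\<^sup>2"] by (cases "D = 0") auto
    thus "x = \<alpha>" "y = \<beta>" using A B D by (auto simp: D_def)
  qed
qed

text \<open>Compactness: new coincidences for \<epsilon> tending to 0 would accumulate either at a
  single point of the circle, against local injectivity, or at an old double point, against its
  rigidity.\<close>

lemma boundary_stability: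
  assumes normal: "\<And>x y. cis x \<noteq> cis y \<Longrightarrow> fpoly d a (cis x) = fpoly d a (cis y) \<Longrightarrow>
      Re (cis (freq d * x) * ((\<Sum>k=1..d. b k / cis x ^ k) - (\<Sum>k=1..d. b k / cis y ^ k))) = 0"
  shows "\<exists>e>0. \<forall>\<epsilon> x \<tau>. \<bar>\<epsilon>\<bar> < e \<longrightarrow> 0 < \<tau> \<longrightarrow> \<tau> \<le> pi \<longrightarrow>
     fpoly d (pert \<epsilon>) (cis x) = fpoly d (pert \<epsilon>) (cis (x + \<tau>)) \<longrightarrow>
     fpoly d a (cis x) = fpoly d a (cis (x + \<tau>))"
proof (rule ccontr)
  assume contra: "\<not> ?thesis"
  define bad where "bad = (\<lambda>n (\<epsilon>, x, \<tau>). \<bar>\<epsilon>\<bar> < 1 / real (Suc n) \<and> 0 < \<tau> \<and> \<tau> \<le> pi \<and> 0 \<le> x \<and> x \<le> 2 * pi \<and>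
     fpoly d (pert \<epsilon>) (cis x) = fpoly d (pert \<epsilon>) (cis (x + \<tau>)) \<and>
     fpoly d a (cis x) \<noteq> fpoly d a (cis (x + \<tau>)))"
  have "\<exists>p. bad n p" for n
  proof -
    have "1 / real (Suc n) > 0" by simp
    then obtain \<epsilon> x \<tau> where *: "\<bar>\<epsilon>\<bar> < 1 / real (Suc n)" "0 < \<tau>" "\<tau> \<le> pi"
       "fpoly d (pert \<epsilon>) (cis x) = fpoly d (pert \<epsilon>) (cis (x + \<tau>))"
       "fpoly d a (cis x) \<noteq> fpoly d a (cis (x + \<tau>))" using contra by blast
    obtain x' where x': "0 \<le> x'" "x' < 2 * pi" "cis x = cis x'"
      using unit_circle_angle[of "cis x"] by (auto simp: norm_cis)
    hence "cis (x + \<tau>) = cis (x' + \<tau>)" by (simp flip: cis_mult)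
    thus ?thesis unfolding bad_def using * x' by (intro exI[of _ "(\<epsilon>, x', \<tau>)"]) auto
  qed
  then obtain f where f: "\<And>n. bad n (f n)" by metis
  define E where "E = (\<lambda>n. fst (f n))"
  define X where "X = (\<lambda>n. fst (snd (f n)))"
  define T where "T = (\<lambda>n. snd (snd (f n)))"
  have *: "\<bar>E n\<bar> < 1 / real (Suc n)" "0 < T n" "T n \<le> pi" "0 \<le> X n" "X n \<le> 2 * pi"
     "fpoly d (pert (E n)) (cis (X n)) = fpoly d (pert (E n)) (cis (X n + T n))"
     "fpoly d a (cis (X n)) \<noteq> fpoly d a (cis (X n + T n))" for n
    using f[of n] unfolding bad_def E_def X_def T_def by (simp_all add: case_prod_unfold)
  have cpt: "compact ({0..2 * pi} \<times> {0..pi})" by (intro compact_Times compact_Icc)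
  have inK: "\<forall>n. (X n, T n) \<in> {0..2 * pi} \<times> {0..pi}"
    using *(2-5) by (auto intro: less_imp_le)
  obtain l \<sigma> where l: "l \<in> {0..2 * pi} \<times> {0..pi}" "strict_mono \<sigma>"
    "((\<lambda>n. (X n, T n)) \<circ> \<sigma>) \<longlonglongrightarrow> l"
    by (rule seq_compactE[OF compact_imp_seq_compact[OF cpt] inK])
  define x where "x = fst l"
  define \<tau> where "\<tau> = snd l"
  have Xl: "(\<lambda>n. X (\<sigma> n)) \<longlonglongrightarrow> x" and Tl: "(\<lambda>n. T (\<sigma> n)) \<longlonglongrightarrow> \<tau>"
    using tendsto_fst[OF l(3)] tendsto_snd[OF l(3)] by (simp_all add: x_def \<tau>_def o_def)
  have "E \<longlonglongrightarrow> 0"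
  proof (rule tendsto_rabs_zero_cancel, rule tendsto_sandwich[of "\<lambda>_. 0" _ _ "\<lambda>n. 1 / real (Suc n)"])
    show "(\<lambda>n. 1 / real (Suc n)) \<longlonglongrightarrow> 0" by (rule LIMSEQ_Suc[OF lim_1_over_n])
    show "\<forall>\<^sub>F n in sequentially. \<bar>E n\<bar> \<le> 1 / real (Suc n)"
      using *(1) by (intro always_eventually allI less_imp_le)
  qed auto
  hence El: "(\<lambda>n. E (\<sigma> n)) \<longlonglongrightarrow> 0" using LIMSEQ_subseq_LIMSEQ[OF _ l(2)] by (simp add: o_def)
  have small: "\<forall>\<^sub>F n in sequentially. \<bar>E (\<sigma> n)\<bar> < \<delta> \<and> \<bar>X (\<sigma> n) - x\<bar> < \<delta> \<and> \<bar>X (\<sigma> n) + T (\<sigma> n) - (x + \<tau>)\<bar> < \<delta>"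
    if "\<delta> > 0" for \<delta>
    using tendstoD[OF El that] tendstoD[OF Xl that] tendstoD[OF tendsto_add[OF Xl Tl] that]
    by eventually_elim (auto simp: dist_real_def)
  show False
  \<comment> \<open>Because \<tau> is at most pi, the two points can merge in the limit only through
    \<tau> = 0.\<close>
  proof (cases "\<tau> = 0")
    case True
    obtain \<delta> where \<delta>: "\<delta> > 0" "\<And>\<epsilon> x' y. \<bar>\<epsilon>\<bar> < \<delta> \<Longrightarrow> \<bar>x' - x\<bar> < \<delta> \<Longrightarrow> \<bar>y - x\<bar> < \<delta> \<Longrightarrow> x' < y \<Longrightarrow>
        fpoly d (pert \<epsilon>) (cis x') \<noteq> fpoly d (pert \<epsilon>) (cis y)"
      using perturbed_arc_injective[of x] by metis
    obtain n where n: "\<bar>E (\<sigma> n)\<bar> < \<delta>" "\<bar>X (\<sigma> n) - x\<bar> < \<delta>" "\<bar>X (\<sigma> n) + T (\<sigma> n) - (x + \<tau>)\<bar> < \<delta>"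
      using eventually_happens[OF small[OF \<delta>(1)]] by auto
    show False
      using \<delta>(2)[of "E (\<sigma> n)" "X (\<sigma> n)" "X (\<sigma> n) + T (\<sigma> n)"] n *(2,6)[of "\<sigma> n"] True by simp
  next
    case False
    hence \<tau>: "0 < \<tau>" "\<tau> \<le> pi" using l(1) by (auto simp: \<tau>_def)
    have ne: "cis x \<noteq> cis (x + \<tau>)" using cis_inj_2pi[of x "x + \<tau>"] \<tau> by auto
    have cont: "isCont (\<lambda>p. fpoly d (pert (fst p)) (cis (snd p))) q" for q
    proof -
      have "continuous_on UNIV (\<lambda>p. fpoly d (pert (fst p)) (cis (snd p)))" by (intro continuous_intros)
      thus ?thesis using continuous_on_eq_continuous_at[OF open_UNIV] by blast
    qed
    have "(\<lambda>n. fpoly d (pert (E (\<sigma> n))) (cis (X (\<sigma> n)))) \<longlonglongrightarrow> fpoly d (pert 0) (cis x)"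
      using isCont_tendsto_compose[OF cont tendsto_Pair[OF El Xl]] by simp
    moreover have "(\<lambda>n. fpoly d (pert (E (\<sigma> n))) (cis (X (\<sigma> n) + T (\<sigma> n)))) \<longlonglongrightarrow> fpoly d (pert 0) (cis (x + \<tau>))"
      using isCont_tendsto_compose[OF cont tendsto_Pair[OF El tendsto_add[OF Xl Tl]]] by simp
    ultimately have eq: "fpoly d a (cis x) = fpoly d a (cis (x + \<tau>))"
      unfolding *(6)[symmetric] using LIMSEQ_unique by fastforce
    obtain \<delta> where \<delta>: "\<delta> > 0" "\<And>\<epsilon> x' y. \<bar>\<epsilon>\<bar> < \<delta> \<Longrightarrow> \<bar>x' - x\<bar> < \<delta> \<Longrightarrow> \<bar>y - (x + \<tau>)\<bar> < \<delta> \<Longrightarrow>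
        fpoly d (pert \<epsilon>) (cis x') = fpoly d (pert \<epsilon>) (cis y) \<Longrightarrow> x' = x \<and> y = x + \<tau>"
      using perturbed_double_pair_rigid[OF ne eq normal[OF ne eq]] by metis
    obtain n where n: "\<bar>E (\<sigma> n)\<bar> < \<delta>" "\<bar>X (\<sigma> n) - x\<bar> < \<delta>" "\<bar>X (\<sigma> n) + T (\<sigma> n) - (x + \<tau>)\<bar> < \<delta>"
      using eventually_happens[OF small[OF \<delta>(1)]] by auto
    have "X (\<sigma> n) = x \<and> X (\<sigma> n) + T (\<sigma> n) = x + \<tau>"
      by (rule \<delta>(2)[OF n *(6)])
    thus False using *(7)[of "\<sigma> n"] eq by metis
  qed
qed

end

section \<open>Counting double points of extreme points\<close>

text \<open>Three normals cannot be pairwise opposite: as the sines vanish, the cosines multiply,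
  and the product of three negative quantities becomes a square.\<close>

lemma no_triple_points:
  assumes a: "a \<in> Sigma_star d" and d: "d \<ge> 1"
    and ne: "cis x \<noteq> cis y" "cis y \<noteq> cis z" "cis x \<noteq> cis z"
    and eq: "fpoly d a (cis x) = fpoly d a (cis y)" "fpoly d a (cis y) = fpoly d a (cis z)"
  shows False
proof -
  note p1 = double_pair_angles[OF a d ne(1) eq(1)]
  note p2 = double_pair_angles[OF a d ne(2) eq(2)]
  note p3 = double_pair_angles[OF a d ne(3) trans[OF eq]]
  let ?c1 = "cos (freq d * (y - x))" and ?c2 = "cos (freq d * (z - y))"
  have "freq d * (z - x) = freq d * (y - x) + freq d * (z - y)" by (simp add: algebra_simps)
  hence c3: "cos (freq d * (z - x)) = ?c1 * ?c2" using p1(1) by (simp add: cos_add)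
  have "(?c1 * Re (tanfac d a x) * Re (tanfac d a y)) * (?c2 * Re (tanfac d a y) * Re (tanfac d a z)) > 0"
    by (rule mult_neg_neg[OF p1(2) p2(2)])
  from mult_pos_neg[OF this p3(2)[unfolded c3]]
  have "(?c1 * ?c2 * Re (tanfac d a x) * Re (tanfac d a y) * Re (tanfac d a z))\<^sup>2 < 0"
    by (simp add: power2_eq_square mult_ac)
  thus False by (simp add: not_less[symmetric])
qed

definition dpairs :: "nat \<Rightarrow> (nat \<Rightarrow> complex) \<Rightarrow> (real \<times> real) set" where
  "dpairs d a = {(x, y). 0 \<le> x \<and> x < y \<and> y < 2 * pi \<and> fpoly d a (cis x) = fpoly d a (cis y)}"

lemma cis_ne_of_angles:
  assumes "0 \<le> x" "x < 2 * pi" "0 \<le> y" "y < 2 * pi" "x \<noteq> y"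
  shows "cis x \<noteq> cis y"
proof -
  have "\<bar>x - y\<bar> < 2 * pi" using assms by linarith
  thus ?thesis using cis_inj_2pi[of x y] assms by auto
qed

text \<open>Without triple points the image determines the pair of angles, so the linear equations
  may be counted by pairs.\<close>

lemma dpairs_bij:
  assumes a: "a \<in> Sigma_star d" and d: "d \<ge> 1"
  shows "bij_betw (\<lambda>p. fpoly d a (cis (fst p))) (dpairs d a) (double_points d a)"
  unfolding bij_betw_def
proof
  show "inj_on (\<lambda>p. fpoly d a (cis (fst p))) (dpairs d a)"
  proof (rule inj_onI)
    fix p q assume pq: "p \<in> dpairs d a" "q \<in> dpairs d a" "fpoly d a (cis (fst p)) = fpoly d a (cis (fst q))"
    obtain x y u v where [simp]: "p = (x, y)" "q = (u, v)" by (cases p, cases q)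
    have o: "0 \<le> x" "x < y" "y < 2 * pi" "0 \<le> u" "u < v" "v < 2 * pi"
      and e: "fpoly d a (cis x) = fpoly d a (cis y)" "fpoly d a (cis y) = fpoly d a (cis u)" "fpoly d a (cis u) = fpoly d a (cis v)"
      using pq by (auto simp: dpairs_def)
    have "s = x \<or> s = y" if s: "0 \<le> s" "s < 2 * pi" "fpoly d a (cis y) = fpoly d a (cis s)" for s
    proof (rule ccontr)
      assume "\<not> ?thesis"
      hence "cis x \<noteq> cis y" "cis y \<noteq> cis s" "cis x \<noteq> cis s" 
        using cis_ne_of_angles[of x y] cis_ne_of_angles[of y s] cis_ne_of_angles[of x s] o s by auto
      thus False using no_triple_points[OF a d] e s by blast
    qed
    from this[of u] this[of v] show "p = q" using o e by auto
  qed
  show "(\<lambda>p. fpoly d a (cis (fst p))) ` dpairs d a = double_points d a"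
  proof (intro equalityI subsetI)
    fix w assume "w \<in> (\<lambda>p. fpoly d a (cis (fst p))) ` dpairs d a"
    then obtain x y where xy: "(x, y) \<in> dpairs d a" "w = fpoly d a (cis x)" by auto
    hence "cis x \<noteq> cis y" by (intro cis_ne_of_angles) (auto simp: dpairs_def)
    thus "w \<in> double_points d a"
      unfolding double_points_def mem_Collect_eq using xy
      by (intro exI[of _ "cis x"] exI[of _ "cis y"]) (simp add: dpairs_def)
  next
    fix w assume "w \<in> double_points d a"
    then obtain x y where "0 \<le> x" "x < y" "y < 2 * pi" "fpoly d a (cis x) = w" "fpoly d a (cis y) = w"
      by (rule double_point_angles)
    thus "w \<in> (\<lambda>p. fpoly d a (cis (fst p))) ` dpairs d a"
      by (auto simp: dpairs_def intro!: image_eqI[of _ _ "(x, y)"])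
  qed
qed

section \<open>The real deformation space and its dimension\<close>

lemma underdetermined_system:
  fixes c :: "'j \<Rightarrow> 'i \<Rightarrow> real"
  assumes "finite J" "finite I" "card J < card I"
  shows "\<exists>x. (\<exists>i\<in>I. x i \<noteq> 0) \<and> (\<forall>j\<in>J. (\<Sum>i\<in>I. c j i * x i) = 0)"
  using assms
proof (induction J arbitrary: I c rule: finite_induct)
  case empty
  thus ?case by (intro exI[of _ "\<lambda>_. 1"]) (auto simp: card_gt_0_iff)
next
  case (insert j J)
  show ?case
  proof (cases "\<forall>i\<in>I. c j i = 0")
    case True
    obtain x where "\<exists>i\<in>I. x i \<noteq> 0" "\<forall>j\<in>J. (\<Sum>i\<in>I. c j i * x i) = 0"
      using insert.IH[of I c] insert.prems insert.hyps by auto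
    thus ?thesis using True by (intro exI[of _ x]) auto
  next
    case False
    then obtain i0 where i0: "i0 \<in> I" "c j i0 \<noteq> 0" by auto
    define I' where "I' = I - {i0}"
    have I': "finite I'" "card J < card I'"
      using insert.prems insert.hyps i0 by (auto simp: I'_def)
    \<comment> \<open>Gaussian elimination: the pivot variable i0 is removed from the remaining
      equations and recovered afterwards from equation j.\<close>
    obtain x where x: "\<exists>i\<in>I'. x i \<noteq> 0"
      "\<And>k. k \<in> J \<Longrightarrow> (\<Sum>i\<in>I'. (c k i - c k i0 * c j i / c j i0) * x i) = 0"
      using insert.IH[OF I', of "\<lambda>k i. c k i - c k i0 * c j i / c j i0"] by auto
    define s where "s = (\<Sum>i\<in>I'. c j i * x i)"
    define y where "y = x(i0 := - s / c j i0)"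
    have sumy: "(\<Sum>i\<in>I. c k i * y i) = (\<Sum>i\<in>I'. c k i * x i) - c k i0 * s / c j i0" for k
    proof -
      have "(\<Sum>i\<in>I. c k i * y i) = c k i0 * y i0 + (\<Sum>i\<in>I'. c k i * y i)"
        unfolding I'_def using insert.prems i0 by (subst sum.remove[of _ i0]) auto
      also have "(\<Sum>i\<in>I'. c k i * y i) = (\<Sum>i\<in>I'. c k i * x i)"
        by (intro sum.cong) (auto simp: y_def I'_def)
      finally show ?thesis by (simp add: y_def)
    qed
    show ?thesis
    proof (intro exI[of _ y] conjI ballI)
      show "\<exists>i\<in>I. y i \<noteq> 0" using x(1) by (auto simp: y_def I'_def)
      fix k assume "k \<in> insert j J"
      then consider "k = j" | "k \<in> J" by auto
      thus "(\<Sum>i\<in>I. c k i * y i) = 0"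
      proof cases
        case 1
        thus ?thesis unfolding sumy using i0 by (simp add: s_def)
      next
        case 2
        have "(\<Sum>i\<in>I'. (c k i - c k i0 * c j i / c j i0) * x i) = (\<Sum>i\<in>I'. c k i * x i) - c k i0 * s / c j i0"
          by (simp add: s_def left_diff_distrib sum_subtractf sum_distrib_left sum_divide_distrib mult.assoc)
        thus ?thesis using x(2)[OF 2] sumy by simp
      qed
    qed
  qed
qed

text \<open>The coefficients satisfy \<open>dircoeff d x (d - 1 - k) = cnj (dircoeff d x k)\<close> for $1 \le k \le d-2$, which keeps the
  tangential factor real, while the $d-2$ real parameters remain independent.\<close>

definition dircoeff :: "nat \<Rightarrow> (nat \<Rightarrow> real) \<Rightarrow> nat \<Rightarrow> complex" where
  "dircoeff d x k = (1 + \<i>) * of_real (x k) + (1 - \<i>) * of_real (x (d - 1 - k))"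

text \<open>Division by - k cancels the factor from differentiation, so the tangential factor
  changes by \<epsilon> times the trigonometric sum with coefficients \<open>dircoeff\<close>. Entry
  d vanishes to preserve a_d.\<close>

definition direction :: "nat \<Rightarrow> (nat \<Rightarrow> real) \<Rightarrow> nat \<Rightarrow> complex" where
  "direction d x k = (if k \<in> {1..d - 2} then - dircoeff d x k / of_nat k else 0)"

lemma sum_reflect:
  fixes F :: "nat \<Rightarrow> 'a::comm_monoid_add"
  assumes "d \<ge> 2"
  shows "(\<Sum>k=1..d - 2. F (d - 1 - k)) = (\<Sum>k=1..d - 2. F k)"
proof -
  have "d - 2 + 1 = d - 1" using assms by simp
  thus ?thesis using sum.atLeastAtMost_rev[of F 1 "d - 2"] by simp
qed

lemma sum_direction:
  fixes h :: "nat \<Rightarrow> complex"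
  shows "(\<Sum>k=1..d. direction d x k * h k) = - (\<Sum>k=1..d - 2. dircoeff d x k / of_nat k * h k)"
proof -
  have "(\<Sum>k=1..d. direction d x k * h k) = (\<Sum>k=1..d - 2. direction d x k * h k)"
    by (rule sum.mono_neutral_right) (auto simp: direction_def)
  also have "\<dots> = (\<Sum>k=1..d - 2. - (dircoeff d x k / of_nat k * h k))"
    by (intro sum.cong) (auto simp: direction_def)
  finally show ?thesis by (simp add: sum_negf)
qed

text \<open>The reflection k to d - 1 - k negates the frequency freq d - k, so conjugation only
  permutes the terms of the added sum.\<close>

lemma tanfac_direction_real:
  assumes a: "a \<in> Sigma_star d" and d: "d \<ge> 2"
  shows "Im (tanfac d (\<lambda>k. a k + of_real \<epsilon> * direction d x k) t) = 0"
proof -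
  define S where "S = (\<Sum>k=1..d - 2. dircoeff d x k * cis ((freq d - real k) * t))"
  have "cnj S = (\<Sum>k=1..d - 2. dircoeff d x (d - 1 - k) * cis ((freq d - real (d - 1 - k)) * t))"
    unfolding S_def cnj_sum
  proof (intro sum.cong refl)
    fix k assume k: "k \<in> {1..d - 2}"
    hence "d - 1 - (d - 1 - k) = k" by auto
    hence 1: "cnj (dircoeff d x k) = dircoeff d x (d - 1 - k)"
      by (simp add: dircoeff_def complex_eq_iff)
    have "real (d - 1 - k) = real d - 1 - real k" using k by auto
    hence "- ((freq d - real k) * t) = (freq d - real (d - 1 - k)) * t"
      by (simp add: freq_def field_simps)
    thus "cnj (dircoeff d x k * cis ((freq d - real k) * t)) = dircoeff d x (d - 1 - k) * cis ((freq d - real (d - 1 - k)) * t)"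
      using 1 by (simp add: cis_cnj)
  qed
  also have "\<dots> = S" unfolding S_def by (rule sum_reflect[OF d])
  finally have "Im S = 0" by (simp add: complex_eq_iff)
  have dS: "(\<Sum>k=1..d. direction d x k * (of_nat k * cis ((freq d - real k) * t))) = - S"
    unfolding sum_direction S_def by (intro arg_cong[of _ _ uminus] sum.cong) auto
  have "tanfac d (\<lambda>k. a k + of_real \<epsilon> * direction d x k) t = tanfac d a t + of_real \<epsilon> * S"
  proof -
    have "(\<Sum>k=1..d. of_nat k * (a k + of_real \<epsilon> * direction d x k) * cis ((freq d - real k) * t))
        = (\<Sum>k=1..d. of_nat k * a k * cis ((freq d - real k) * t))
          + of_real \<epsilon> * (\<Sum>k=1..d. direction d x k * (of_nat k * cis ((freq d - real k) * t)))"
      by (simp only: distrib_left distrib_right sum.distrib sum_distrib_left mult_ac)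
    thus ?thesis unfolding tanfac_eq dS by simp
  qed
  thus ?thesis using tanfac_real[OF a, of t] d \<open>Im S = 0\<close> by simp
qed

text \<open>The coefficients of \<open>direction\<close> depend real-linearly on x. A double point
  therefore imposes a single real linear equation and costs at most one dimension.\<close>

lemma direction_functional_linear:
  assumes d: "d \<ge> 2"
  shows "\<exists>c. \<forall>x. Re (\<nu> * ((\<Sum>k=1..d. direction d x k / z ^ k) - (\<Sum>k=1..d. direction d x k / w ^ k)))
             = (\<Sum>k=1..d - 2. c k * x k)"
proof -
  define h where "h = (\<lambda>k. \<nu> * (1 / z ^ k - 1 / w ^ k) / of_nat k)"
  define c where "c = (\<lambda>k. - Re ((1 + \<i>) * h k) - Re ((1 - \<i>) * h (d - 1 - k)))"
  have "Re (\<nu> * ((\<Sum>k=1..d. direction d x k / z ^ k) - (\<Sum>k=1..d. direction d x k / w ^ k)))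
             = (\<Sum>k=1..d - 2. c k * x k)" for x
  proof -
    have "\<nu> * ((\<Sum>k=1..d. direction d x k / z ^ k) - (\<Sum>k=1..d. direction d x k / w ^ k))
       = (\<Sum>k=1..d. direction d x k * (\<nu> * (1 / z ^ k - 1 / w ^ k)))"
      by (simp add: sum_distrib_left sum_subtractf right_diff_distrib mult_ac)
    also have "\<dots> = - (\<Sum>k=1..d - 2. dircoeff d x k * h k)"
      unfolding sum_direction by (simp add: h_def)
    finally have "Re (\<nu> * ((\<Sum>k=1..d. direction d x k / z ^ k) - (\<Sum>k=1..d. direction d x k / w ^ k)))
       = - (\<Sum>k=1..d - 2. Re (dircoeff d x k * h k))" by simp
    also have "(\<Sum>k=1..d - 2. Re (dircoeff d x k * h k))
       = (\<Sum>k=1..d - 2. Re ((1 + \<i>) * h k) * x k + Re ((1 - \<i>) * h k) * x (d - 1 - k))"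
      by (intro sum.cong) (auto simp: dircoeff_def algebra_simps)
    also have "\<dots> = (\<Sum>k=1..d - 2. Re ((1 + \<i>) * h k) * x k) + (\<Sum>k=1..d - 2. Re ((1 - \<i>) * h k) * x (d - 1 - k))"
      by (rule sum.distrib)
    also have "(\<Sum>k=1..d - 2. Re ((1 - \<i>) * h k) * x (d - 1 - k)) = (\<Sum>k=1..d - 2. Re ((1 - \<i>) * h (d - 1 - k)) * x k)"
    proof -
      have "(\<Sum>k=1..d - 2. Re ((1 - \<i>) * h k) * x (d - 1 - k))
          = (\<Sum>k=1..d - 2. Re ((1 - \<i>) * h (d - 1 - k)) * x (d - 1 - (d - 1 - k)))"
        by (rule sum_reflect[OF d, symmetric])
      also have "\<dots> = (\<Sum>k=1..d - 2. Re ((1 - \<i>) * h (d - 1 - k)) * x k)"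
      proof (intro sum.cong refl)
        fix k assume "k \<in> {1..d - 2}"
        hence "d - 1 - (d - 1 - k) = k" by auto
        thus "Re ((1 - \<i>) * h (d - 1 - k)) * x (d - 1 - (d - 1 - k)) = Re ((1 - \<i>) * h (d - 1 - k)) * x k" by simp
      qed
      finally show ?thesis .
    qed
    also have "- ((\<Sum>k=1..d - 2. Re ((1 + \<i>) * h k) * x k) + (\<Sum>k=1..d - 2. Re ((1 - \<i>) * h (d - 1 - k)) * x k))
        = (\<Sum>k=1..d - 2. c k * x k)"
      unfolding c_def left_diff_distrib sum_subtractf mult_minus_left sum_negf by (simp only: minus_add_distrib diff_conv_add_uminus)
    finally show ?thesis .
  qed
  thus ?thesis by blast
qed

section \<open>The lower bound for extreme points\<close>

lemma unit_pair_angles: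
  assumes "norm z = 1" "norm w = 1" "z \<noteq> w"
  shows "\<exists>x \<tau>. 0 < \<tau> \<and> \<tau> \<le> pi \<and> (z = cis x \<and> w = cis (x + \<tau>) \<or> w = cis x \<and> z = cis (x + \<tau>))"
proof -
  obtain x where x: "0 \<le> x" "x < 2 * pi" "z = cis x" using unit_circle_angle[OF assms(1)] by metis
  obtain y where y: "0 \<le> y" "y < 2 * pi" "w = cis y" using unit_circle_angle[OF assms(2)] by metis
  have per: "cis (t + 2 * pi) = cis t" for t by (simp add: complex_eq_iff)
  have ne: "x \<noteq> y" using assms x y by auto
  consider "0 < y - x" "y - x \<le> pi" | "pi < y - x" | "0 < x - y" "x - y \<le> pi" | "pi < x - y" using ne by linarith
  thus ?thesis
  proof cases
    case 1
    thus ?thesis using x y by (intro exI[of _ x] exI[of _ "y - x"]) auto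
  next
    case 2
    have "z = cis (y + (x + 2 * pi - y))" using x per[of x] by simp
    thus ?thesis using 2 x y by (intro exI[of _ y] exI[of _ "x + 2 * pi - y"]) auto
  next
    case 3
    thus ?thesis using x y by (intro exI[of _ y] exI[of _ "x - y"]) auto
  next
    case 4
    have "w = cis (x + (y + 2 * pi - x))" using y per[of y] by simp
    thus ?thesis using 4 x y by (intro exI[of _ x] exI[of _ "y + 2 * pi - x"]) auto
  qed
qed

text \<open>The normals at both ends of a chord are real multiples of each other, so one equation
  per ordered pair also serves the reversed pair. The conjugate normal is a nonzero real multiple of
  cis (freq d * x), the form used for stability.\<close>

lemma normal_condition_from_dpairs:
  fixes G :: "complex \<Rightarrow> complex"
  assumes a: "a \<in> Sigma_star d" and d: "d \<ge> 1"
    and N: "\<And>x y. (x, y) \<in> dpairs d a \<Longrightarrow> Re (cnj (cis x * fprime d a (cis x)) * (G (cis x) - G (cis y))) = 0"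
    and ne: "cis x \<noteq> cis y" and eq: "fpoly d a (cis x) = fpoly d a (cis y)"
  shows "Re (cis (freq d * x) * (G (cis x) - G (cis y))) = 0"
proof -
  have aS: "a \<in> Sigma_d d" using a by (simp add: Sigma_star_def)
  define n1 where "n1 = cis x * fprime d a (cis x)"
  define n2 where "n2 = cis y * fprime d a (cis y)"
  obtain x' where x': "0 \<le> x'" "x' < 2 * pi" "cis x = cis x'" using unit_circle_angle[of "cis x"] by (auto simp: norm_cis)
  obtain y' where y': "0 \<le> y'" "y' < 2 * pi" "cis y = cis y'" using unit_circle_angle[of "cis y"] by (auto simp: norm_cis)
  have "x' \<noteq> y'" using ne x' y' by auto
  then consider "x' < y'" | "y' < x'" by linarith
  hence R: "Re (cnj n1 * (G (cis x) - G (cis y))) = 0"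
  proof cases
    case 1
    hence "(x', y') \<in> dpairs d a" using x' y' eq by (simp add: dpairs_def)
    from N[OF this] show ?thesis using x' y' by (simp add: n1_def)
  next
    case 2
    hence "(y', x') \<in> dpairs d a" using x' y' eq by (simp add: dpairs_def)
    from N[OF this] have "Re (cnj n2 * (G (cis y) - G (cis x))) = 0" using x' y' by (simp add: n2_def)
    moreover obtain t where "n1 = of_real t * n2"
      using double_point_tangency(3)[OF aS _ _ ne eq] by (auto simp: n1_def n2_def)
    moreover have "Re (cnj (of_real t * n2) * (G (cis x) - G (cis y))) = - t * Re (cnj n2 * (G (cis y) - G (cis x)))"
      by (simp add: algebra_simps)
    ultimately show ?thesis by simp
  qed
  define r where "r = Re (tanfac d a x)"
  have r: "tanfac d a x = of_real r" using tanfac_real[OF a d] by (simp add: r_def complex_eq_iff)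
  have "tanfac d a x \<noteq> 0"
    using double_point_tangency(1)[OF aS _ _ ne eq] by (auto simp: tanfac_def)
  hence r0: "r \<noteq> 0" by (simp add: r)
  have "n1 = cis (- freq d * x) * tanfac d a x"
    unfolding n1_def tanfac_def mult.assoc[symmetric] cis_mult by (simp add: algebra_simps)
  hence "cnj n1 = of_real r * cis (freq d * x)" unfolding r by (simp add: cis_cnj)
  hence "r * Re (cis (freq d * x) * (G (cis x) - G (cis y))) = 0"
    using R by (simp add: mult.assoc)
  thus ?thesis using r0 by simp
qed

lemma double_points_card_ge:
  assumes d: "d \<ge> 2" and ext: "extreme_point (Sigma_star d) a"
  shows "card (double_points d a) \<ge> d - 2"
proof (rule ccontr)
  assume "\<not> ?thesis"
  hence lt: "card (double_points d a) < d - 2" by simp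
  have a: "a \<in> Sigma_star d" using ext by (simp add: extreme_point_def)
  have aS: "a \<in> Sigma_d d" using a by (simp add: Sigma_star_def)
  have d1: "d \<ge> 1" using d by simp
  let ?D = "dpairs d a"
  have bij: "bij_betw (\<lambda>p. fpoly d a (cis (fst p))) ?D (double_points d a)" by (rule dpairs_bij[OF a d1])
  have finD: "finite ?D" using bij_betw_finite[OF bij] double_points_card_le[OF a d] by simp
  have cardD: "card ?D < card {1..d - 2}" using bij_betw_same_card[OF bij] lt by simp
  define \<nu> where "\<nu> = (\<lambda>p::real \<times> real. cnj (cis (fst p) * fprime d a (cis (fst p))))"
  have "\<forall>p. \<exists>c. \<forall>x. Re (\<nu> p * ((\<Sum>k=1..d. direction d x k / cis (fst p) ^ k) - (\<Sum>k=1..d. direction d x k / cis (snd p) ^ k)))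
             = (\<Sum>k=1..d - 2. c k * x k)"
    using direction_functional_linear[OF d] by blast
  from choice[OF this] obtain c where c: "\<And>p x. Re (\<nu> p * ((\<Sum>k=1..d. direction d x k / cis (fst p) ^ k) - (\<Sum>k=1..d. direction d x k / cis (snd p) ^ k)))
             = (\<Sum>k=1..d - 2. c p k * x k)" by blast
  obtain x where x: "\<exists>k\<in>{1..d - 2}. x k \<noteq> 0" "\<And>p. p \<in> ?D \<Longrightarrow> (\<Sum>k=1..d - 2. c p k * x k) = 0"
    using underdetermined_system[OF finD _ cardD, of c] by auto
  define b where "b = direction d x"
  \<comment> \<open>1 + i and 1 - i are independent over the reals, so a nonzero parameter gives a
    nonzero coefficient.\<close>
  have b0: "\<exists>k. b k \<noteq> 0"
  proof -
    obtain k where k: "k \<in> {1..d - 2}" "x k \<noteq> 0" using x(1) by auto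
    have "dircoeff d x k \<noteq> 0" using k(2) by (auto simp: dircoeff_def complex_eq_iff)
    hence "b k \<noteq> 0" using k(1) by (auto simp: b_def direction_def)
    thus ?thesis by blast
  qed
  have real: "Im (tanfac d (\<lambda>k. a k + of_real \<epsilon> * b k) t) = 0" for \<epsilon> t
    unfolding b_def by (rule tanfac_direction_real[OF a d])
  have normal: "Re (cis (freq d * s) * ((\<Sum>k=1..d. b k / cis s ^ k) - (\<Sum>k=1..d. b k / cis t ^ k))) = 0"
    if "cis s \<noteq> cis t" "fpoly d a (cis s) = fpoly d a (cis t)" for s t
  proof (rule normal_condition_from_dpairs[where G = "\<lambda>z. \<Sum>k=1..d. b k / z ^ k", OF a d1 _ that])
    fix u v assume "(u, v) \<in> ?D"
    thus "Re (cnj (cis u * fprime d a (cis u)) * ((\<Sum>k=1..d. b k / cis u ^ k) - (\<Sum>k=1..d. b k / cis v ^ k))) = 0"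
      using c[of "(u, v)" x] x(2)[of "(u, v)"] unfolding b_def \<nu>_def fst_conv snd_conv by metis
  qed
  obtain e where e: "e > 0" and stab: "\<And>\<epsilon> x \<tau>. \<lbrakk>\<bar>\<epsilon>\<bar> < e; 0 < \<tau>; \<tau> \<le> pi;
     fpoly d (\<lambda>k. a k + of_real \<epsilon> * b k) (cis x) = fpoly d (\<lambda>k. a k + of_real \<epsilon> * b k) (cis (x + \<tau>))\<rbrakk>
     \<Longrightarrow> fpoly d a (cis x) = fpoly d a (cis (x + \<tau>))"
    using boundary_stability[OF a d real normal] by blast
  have stab': "fpoly d a z = fpoly d a w"
    if h: "\<bar>\<epsilon>\<bar> < e" "norm z = 1" "norm w = 1" "z \<noteq> w"
      "fpoly d (\<lambda>k. a k + of_real \<epsilon> * b k) z = fpoly d (\<lambda>k. a k + of_real \<epsilon> * b k) w" for \<epsilon> z w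
  proof -
    obtain x \<tau> where "0 < \<tau>" "\<tau> \<le> pi" "z = cis x \<and> w = cis (x + \<tau>) \<or> w = cis x \<and> z = cis (x + \<tau>)"
      using unit_pair_angles[OF h(2-4)] by blast
    thus ?thesis using stab[OF h(1), of \<tau> x] h(5) by auto
  qed
  \<comment> \<open>Only the ratios of the double points of f; by stability they serve for all small
    perturbations.\<close>
  define B where "B = {u / v | u v. norm u = 1 \<and> norm v = 1 \<and> u \<noteq> v \<and> fpoly d a (inverse u) = fpoly d a (inverse v)}"
  have "B \<subseteq> (\<lambda>p. cis (snd p - fst p)) ` ?D \<union> (\<lambda>p. cis (fst p - snd p)) ` ?D"
  proof
    fix q assume "q \<in> B"
    then obtain u v where uv: "q = u / v" "norm u = 1" "norm v = 1" "u \<noteq> v" "fpoly d a (inverse u) = fpoly d a (inverse v)"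
      by (auto simp: B_def)
    obtain s where s: "0 \<le> s" "s < 2 * pi" "inverse u = cis s" using unit_circle_angle[of "inverse u"] uv by (auto simp: norm_inverse)
    obtain t where t: "0 \<le> t" "t < 2 * pi" "inverse v = cis t" using unit_circle_angle[of "inverse v"] uv by (auto simp: norm_inverse)
    have "q = inverse v / inverse u" by (simp add: uv divide_inverse mult.commute)
    also have "\<dots> = cis (t - s)" by (simp add: s t cis_divide)
    finally have q: "q = cis (t - s)" .
    have "inverse u \<noteq> inverse v" using uv by simp
    hence "s \<noteq> t" using s t by auto
    then consider "s < t" | "t < s" by linarith
    thus "q \<in> (\<lambda>p. cis (snd p - fst p)) ` ?D \<union> (\<lambda>p. cis (fst p - snd p)) ` ?D"
    proof cases
      case 1
      hence "(s, t) \<in> ?D" using s t uv(5) by (simp add: dpairs_def)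
      thus ?thesis unfolding q by (intro UnI1 image_eqI[of _ _ "(s, t)"]) auto
    next
      case 2
      hence "(t, s) \<in> ?D" using s t uv(5) by (simp add: dpairs_def)
      thus ?thesis unfolding q by (intro UnI2 image_eqI[of _ _ "(t, s)"]) auto
    qed
  qed
  hence finB: "finite B" by (rule finite_subset) (use finD in auto)
  have univ: "(\<lambda>k. a k + of_real \<epsilon> * b k) \<in> Sigma_star d" if \<epsilon>: "\<bar>\<epsilon>\<bar> < e" for \<epsilon>
  proof -
    have bz: "b k = 0" if "k = 0 \<or> k \<ge> d" for k using that d by (auto simp: b_def direction_def)
    have ok: "coeffs_ok d (\<lambda>k. a k + of_real \<epsilon> * b k)"
      using aS bz by (auto simp: Sigma_d_def coeffs_ok_def)
    have "(\<lambda>k. a k + of_real \<epsilon> * b k) \<in> Sigma_d d"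
    proof (rule univalent_homotopy[OF aS ok finB])
      fix s :: real and u v :: complex
      assume s: "s \<in> {0..1}" and uv: "norm u = 1" "norm v = 1" "u \<noteq> v" "u / v \<notin> B"
      have nz: "u \<noteq> 0" "v \<noteq> 0" using uv by auto
      \<comment> \<open>The homotopy to f + \<epsilon> g passes through f + s \<epsilon> g, so
        stability is applied at s \<epsilon>.\<close>
      have "\<bar>s * \<epsilon>\<bar> \<le> 1 * \<bar>\<epsilon>\<bar>" unfolding abs_mult using s by (intro mult_right_mono) auto
      hence se: "\<bar>s * \<epsilon>\<bar> < e" using \<epsilon> by simp
      have "fpoly d (\<lambda>k. a k + of_real (s * \<epsilon>) * b k) (inverse u) \<noteq> fpoly d (\<lambda>k. a k + of_real (s * \<epsilon>) * b k) (inverse v)"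
      proof
        assume "fpoly d (\<lambda>k. a k + of_real (s * \<epsilon>) * b k) (inverse u) = fpoly d (\<lambda>k. a k + of_real (s * \<epsilon>) * b k) (inverse v)"
        from stab'[OF se _ _ _ this] have "fpoly d a (inverse u) = fpoly d a (inverse v)"
          using uv by (simp add: norm_inverse)
        hence "u / v \<in> B" unfolding B_def using uv by blast
        thus False using uv by simp
      qed
      hence "ddiff d (\<lambda>k. a k + of_real (s * \<epsilon>) * b k) u v \<noteq> 0"
        using ddiff_eq_0_iff[OF nz uv(3)] by simp
      thus "ddiff d (\<lambda>k. a k + of_real s * (of_real \<epsilon> * b k)) u v \<noteq> 0"
        by (simp add: mult.assoc)
    qed
    thus ?thesis using a bz[of d] by (simp add: Sigma_star_def)
  qed
  define a1 where "a1 = (\<lambda>k. a k + of_real (e / 2) * b k)"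
  define a2 where "a2 = (\<lambda>k. a k + of_real (- (e / 2)) * b k)"
  have "a1 \<in> Sigma_star d" "a2 \<in> Sigma_star d"
    unfolding a1_def a2_def using e by (auto intro!: univ simp del: of_real_minus of_real_divide)
  moreover have "a = (\<lambda>k. (a1 k + a2 k) / 2)" by (simp add: a1_def a2_def fun_eq_iff)
  moreover have "a1 \<noteq> a2"
  proof
    assume eq12: "a1 = a2"
    obtain k where k: "b k \<noteq> 0" using b0 by blast
    have "a1 k - a2 k = of_real e * b k" by (simp add: a1_def a2_def algebra_simps)
    thus False using eq12 k e by simp
  qed
  ultimately show False using ext unfolding extreme_point_def by blast
qed

theorem theorem2p8:
  fixes d :: nat and f :: "nat \<Rightarrow> complex"
  assumes "d \<ge> 2"
    and "extreme_point (Sigma_star d) f"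
  shows "suffridge d f"
proof -
  have f: "f \<in> Sigma_star d" using assms by (simp add: extreme_point_def)
  hence "f \<in> Sigma_d d" by (simp add: Sigma_star_def)
  thus ?thesis
    using cusps_card[OF f] double_points_card_le[OF f assms(1)] double_points_card_ge[OF assms] assms(1)
    by (simp add: suffridge_def)
qed

end
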